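(* The category of crossed modules in $\mathsf{C}$ and the category of cat$^{1}$-groups with operations in $\mathsf{C}$ are equivalent.
   Context: Groups with operations. $\mathsf{C}$ is a fixed category of groups with operations: its objects are the algebras with a set $\Omega$ of operations satisfying a set $\mathsf{E}$ of identities, where $\mathsf{E}$ includes the group laws and, with $\Omega_i$ the set of $i$-ary operations: (a) $\Omega=\Omega_0\cup\Omega_1\cup\Omega_2$; (b) the group operations $0,-,+$ (written additively, $+$ not necessarily commutative) belong to $\Omega_0,\Omega_1,\Omega_2$ respectively, $\Omega_0=\{0\}$, and with $\Omega_1'=\Omega_1\setminus\{-\}$, $\Omega_2'=\Omega_2\setminus\{+\}$, if $\star\in\Omega_2'$ then the operation $a\star^{\circ}b=b\star a$ is also in $\Omega_2'$; (c) for each $\star\in\Omega_2'$, $\mathsf{E}$ includes $a\star(b+c)=a\star b+a\star c$; (d) for $\omega\in\Omega_1'$, $\star\in\Omega_2'$, $\mathsf{E}$ includes $\omega(a+b)=\omega(a)+\omega(b)$ and $\omega(a)\star b=\omega(a\star b)$. Morphisms are group homomorphisms preserving all operations in $\Omega_1'$ and $\Omega_2'$. Crossed modules. Derived actions of $B$ on $A$ (objects of $\mathsf{C}$) are the maps $b\cdot a=s(b)+a-s(b)$ and $b\star a=s(b)\star a$ ($\star\in\Omega_2'$) obtained from a split extension $0\to A\to E\xrightarrow{p}B\to 0$ in $\mathsf{C}$ ($p$ surjective, $A=\ker p$, $s\colon B\to E$ a morphism with $ps=\mathrm{id}_B$). One writes $a\star b:=b\star^{\circ}a$. A crossed module $(A,B,\alpha)$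 in $\mathsf{C}$ consists of objects $A,B$, derived actions of $B$ on $A$, and a morphism $\alpha\colon A\to B$ such that for all $b\in B$, $a,a'\in A$, $\star\in\Omega_2'$: $\alpha(b\cdot a)=b+\alpha(a)-b$; $\alpha(a)\cdot a'=a+a'-a$; $\alpha(a)\star a'=a\star a'$; $\alpha(b\star a)=b\star\alpha(a)$ and $\alpha(a\star b)=\alpha(a)\star b$. A morphism $(A,B,\alpha)\to(A',B',\alpha')$ is a pair of morphisms $f\colon A\to A'$, $g\colon B\to B'$ in $\mathsf{C}$ with $g\alpha=\alpha'f$, $f(b\cdot a)=g(b)\cdot f(a)$ and $f(b\star a)=g(b)\star f(a)$ for all $a\in A,b\in B,\star\in\Omega_2'$. Cat$^1$-groups with operations. A cat$^1$-group with operations in $\mathsf{C}$ is a triple $(A,s,t)$ with $A$ an object of $\mathsf{C}$ and $s,t$ endomorphisms of $A$ in $\mathsf{C}$ such that (i) $st=t$ and $ts=s$; (ii) $[\ker s,\ker t]=0$, i.e. elements of $\ker s$ and $\ker t$ commute under $+$; (iii) $\ker s\star\ker t=0$, i.e. $x\star y=0$ for all $x\in\ker s$, $y\in\ker t$, $\star\in\Omega_2'$. A morphism $(A,s,t)\to(A',s',t')$ is a morphism $f\colon A\to A'$ in $\mathsf{C}$ with $fs=s'f$ and $ft=t'f$. *)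

theory Defs
  imports "HOL-Algebra.Coset"
begin

section \<open>Categories and equivalences of categories\<close>

text \<open>Hom-sets for different pairs of objects need not be disjoint, so composition and the
  action of a functor on morphisms take the objects involved as arguments:
  \<open>Comp C X Y Z g f\<close> is \<open>g \<circ> f\<close> for \<open>f : X \<rightarrow> Y\<close> and \<open>g : Y \<rightarrow> Z\<close>.\<close>

record ('o, 'm) cat =
  Obj :: "'o set"
  Hom :: "'o \<Rightarrow> 'o \<Rightarrow> 'm set"
  Ident :: "'o \<Rightarrow> 'm"
  Comp :: "'o \<Rightarrow> 'o \<Rightarrow> 'o \<Rightarrow> 'm \<Rightarrow> 'm \<Rightarrow> 'm"

definition category :: "('o, 'm) cat \<Rightarrow> bool" where
  "category C \<longleftrightarrow>
    (\<forall>X\<in>Obj C. Ident C X \<in> Hom C X X) \<and>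
    (\<forall>X\<in>Obj C. \<forall>Y\<in>Obj C. \<forall>Z\<in>Obj C. \<forall>f\<in>Hom C X Y. \<forall>g\<in>Hom C Y Z.
       Comp C X Y Z g f \<in> Hom C X Z) \<and>
    (\<forall>X\<in>Obj C. \<forall>Y\<in>Obj C. \<forall>f\<in>Hom C X Y.
       Comp C X X Y f (Ident C X) = f \<and> Comp C X Y Y (Ident C Y) f = f) \<and>
    (\<forall>W\<in>Obj C. \<forall>X\<in>Obj C. \<forall>Y\<in>Obj C. \<forall>Z\<in>Obj C.
     \<forall>f\<in>Hom C W X. \<forall>g\<in>Hom C X Y. \<forall>h\<in>Hom C Y Z.
       Comp C W X Z (Comp C X Y Z h g) f = Comp C W Y Z h (Comp C W X Y g f))"

definition is_functor ::
  "('o, 'm) cat \<Rightarrow> ('p, 'n) cat \<Rightarrow> ('o \<Rightarrow> 'p) \<Rightarrow> ('o \<Rightarrow> 'o \<Rightarrow> 'm \<Rightarrow> 'n) \<Rightarrow> bool" where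
  "is_functor C D Fo Fm \<longleftrightarrow>
    (\<forall>X\<in>Obj C. Fo X \<in> Obj D) \<and>
    (\<forall>X\<in>Obj C. \<forall>Y\<in>Obj C. \<forall>f\<in>Hom C X Y. Fm X Y f \<in> Hom D (Fo X) (Fo Y)) \<and>
    (\<forall>X\<in>Obj C. Fm X X (Ident C X) = Ident D (Fo X)) \<and>
    (\<forall>X\<in>Obj C. \<forall>Y\<in>Obj C. \<forall>Z\<in>Obj C. \<forall>f\<in>Hom C X Y. \<forall>g\<in>Hom C Y Z.
       Fm X Z (Comp C X Y Z g f) = Comp D (Fo X) (Fo Y) (Fo Z) (Fm Y Z g) (Fm X Y f))"

definition isomorphism :: "('o, 'm) cat \<Rightarrow> 'o \<Rightarrow> 'o \<Rightarrow> 'm \<Rightarrow> bool" where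
  "isomorphism C X Y f \<longleftrightarrow> f \<in> Hom C X Y \<and>
    (\<exists>g\<in>Hom C Y X. Comp C X Y X g f = Ident C X \<and> Comp C Y X Y f g = Ident C Y)"

definition natural_isomorphism ::
  "('o, 'm) cat \<Rightarrow> ('p, 'n) cat \<Rightarrow>
   ('o \<Rightarrow> 'p) \<Rightarrow> ('o \<Rightarrow> 'o \<Rightarrow> 'm \<Rightarrow> 'n) \<Rightarrow> ('o \<Rightarrow> 'p) \<Rightarrow> ('o \<Rightarrow> 'o \<Rightarrow> 'm \<Rightarrow> 'n) \<Rightarrow>
   ('o \<Rightarrow> 'n) \<Rightarrow> bool" where
  "natural_isomorphism C D Fo Fm Go Gm \<eta> \<longleftrightarrow>
    (\<forall>X\<in>Obj C. isomorphism D (Fo X) (Go X) (\<eta> X)) \<and>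
    (\<forall>X\<in>Obj C. \<forall>Y\<in>Obj C. \<forall>f\<in>Hom C X Y.
       Comp D (Fo X) (Go X) (Go Y) (Gm X Y f) (\<eta> X) =
       Comp D (Fo X) (Fo Y) (Go Y) (\<eta> Y) (Fm X Y f))"

definition equivalent_categories :: "('o, 'm) cat \<Rightarrow> ('p, 'n) cat \<Rightarrow> bool" where
  "equivalent_categories C D \<longleftrightarrow> category C \<and> category D \<and>
    (\<exists>Fo Fm Go Gm \<eta> \<epsilon>.
       is_functor C D Fo Fm \<and> is_functor D C Go Gm \<and>
       natural_isomorphism C C (\<lambda>X. X) (\<lambda>X Y f. f)
         (\<lambda>X. Go (Fo X)) (\<lambda>X Y f. Gm (Fo X) (Fo Y) (Fm X Y f)) \<eta> \<and>
       natural_isomorphism D D (\<lambda>X. Fo (Go X)) (\<lambda>X Y f. Fm (Go X) (Go Y) (Gm X Y f))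
         (\<lambda>X. X) (\<lambda>X Y f. f) \<epsilon>)"


section \<open>Groups with operations\<close>

datatype (usyms: 'w, bsyms: 's) gterm =
  TVar nat
| TZero
| TNeg "('w, 's) gterm"
| TAdd "('w, 's) gterm" "('w, 's) gterm"
| TUn 'w "('w, 's) gterm"
| TBin 's "('w, 's) gterm" "('w, 's) gterm"

text \<open>\<open>unary\<close> and \<open>binary\<close> are \<open>\<Omega>\<^sub>1' = \<Omega>\<^sub>1 - {-}\<close> and \<open>\<Omega>\<^sub>2' = \<Omega>\<^sub>2 - {+}\<close>; the group operations
  \<open>0\<close>, \<open>-\<close>, \<open>+\<close> have their own term constructors. \<open>opp\<close> sends \<open>\<star>\<close> to \<open>\<star>\<^sup>\<circ>\<close>.\<close>

record ('w, 's) gwo_theory =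
  unary :: "'w set"
  binary :: "'s set"
  opp :: "'s \<Rightarrow> 's"
  identities :: "(('w, 's) gterm \<times> ('w, 's) gterm) set"

text \<open>The group laws are not listed among the identities: they are imposed on every object
  through the predicate \<open>group\<close>.\<close>

definition groups_with_operations :: "('w, 's) gwo_theory \<Rightarrow> bool" where
  "groups_with_operations T \<longleftrightarrow>
    (\<forall>(l, r)\<in>identities T.
       usyms l \<union> usyms r \<subseteq> unary T \<and> bsyms l \<union> bsyms r \<subseteq> binary T) \<and>
    (\<forall>st\<in>binary T. opp T st \<in> binary T \<and>
       (TBin (opp T st) (TVar 0) (TVar 1), TBin st (TVar 1) (TVar 0)) \<in> identities T) \<and>
    (\<forall>st\<in>binary T.
       (TBin st (TVar 0) (TAdd (TVar 1) (TVar 2)),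
        TAdd (TBin st (TVar 0) (TVar 1)) (TBin st (TVar 0) (TVar 2))) \<in> identities T) \<and>
    (\<forall>w\<in>unary T.
       (TUn w (TAdd (TVar 0) (TVar 1)),
        TAdd (TUn w (TVar 0)) (TUn w (TVar 1))) \<in> identities T) \<and>
    (\<forall>w\<in>unary T. \<forall>st\<in>binary T.
       (TBin st (TUn w (TVar 0)) (TVar 1), TUn w (TBin st (TVar 0) (TVar 1))) \<in> identities T)"

text \<open>The group operation is written multiplicatively, as in \<open>HOL-Algebra\<close>: \<open>+\<close>, \<open>0\<close>, \<open>-\<close> are
  \<open>\<otimes>\<close>, \<open>\<one>\<close>, \<open>inv\<close>. Carriers are subsets of the type \<open>'u\<close>, which serves as the universe.\<close>

record ('u, 'w, 's) gwo = "'u monoid" +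
  uop :: "'w \<Rightarrow> 'u \<Rightarrow> 'u"
  bop :: "'s \<Rightarrow> 'u \<Rightarrow> 'u \<Rightarrow> 'u"

primrec eval :: "('u, 'w, 's) gwo \<Rightarrow> (nat \<Rightarrow> 'u) \<Rightarrow> ('w, 's) gterm \<Rightarrow> 'u" where
  "eval A v (TVar n) = v n"
| "eval A v TZero = \<one>\<^bsub>A\<^esub>"
| "eval A v (TNeg x) = inv\<^bsub>A\<^esub> (eval A v x)"
| "eval A v (TAdd x y) = eval A v x \<otimes>\<^bsub>A\<^esub> eval A v y"
| "eval A v (TUn w x) = uop A w (eval A v x)"
| "eval A v (TBin st x y) = bop A st (eval A v x) (eval A v y)"

definition gwo_obj :: "('w, 's) gwo_theory \<Rightarrow> ('u, 'w, 's) gwo \<Rightarrow> bool" where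
  "gwo_obj T A \<longleftrightarrow> group A \<and>
    (\<forall>w\<in>unary T. \<forall>x\<in>carrier A. uop A w x \<in> carrier A) \<and>
    (\<forall>st\<in>binary T. \<forall>x\<in>carrier A. \<forall>y\<in>carrier A. bop A st x y \<in> carrier A) \<and>
    (\<forall>(l, r)\<in>identities T. \<forall>v. range v \<subseteq> carrier A \<longrightarrow> eval A v l = eval A v r)"

text \<open>Morphisms are taken to be extensional (\<open>undefined\<close> off the carrier), so that they are equal
  iff they agree on the carrier.\<close>

definition gwo_hom ::
  "('w, 's) gwo_theory \<Rightarrow> ('u, 'w, 's) gwo \<Rightarrow> ('u, 'w, 's) gwo \<Rightarrow> ('u \<Rightarrow> 'u) set" where
  "gwo_hom T A B = {f \<in> hom A B \<inter> extensional (carrier A).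
    (\<forall>w\<in>unary T. \<forall>x\<in>carrier A. f (uop A w x) = uop B w (f x)) \<and>
    (\<forall>st\<in>binary T. \<forall>x\<in>carrier A. \<forall>y\<in>carrier A. f (bop A st x y) = bop B st (f x) (f y))}"


section \<open>Crossed modules\<close>

definition split_extension ::
  "('w, 's) gwo_theory \<Rightarrow> ('u, 'w, 's) gwo \<Rightarrow> ('u, 'w, 's) gwo \<Rightarrow> ('u, 'w, 's) gwo \<Rightarrow>
   ('u \<Rightarrow> 'u) \<Rightarrow> ('u \<Rightarrow> 'u) \<Rightarrow> ('u \<Rightarrow> 'u) \<Rightarrow> bool" where
  "split_extension T A E B i p s \<longleftrightarrow>
    gwo_obj T A \<and> gwo_obj T E \<and> gwo_obj T B \<and>
    i \<in> gwo_hom T A E \<and> p \<in> gwo_hom T E B \<and> s \<in> gwo_hom T B E \<and>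
    inj_on i (carrier A) \<and> i ` carrier A = kernel E B p \<and>
    p ` carrier E = carrier B \<and> (\<forall>b\<in>carrier B. p (s b) = b)"

text \<open>\<open>dot b a\<close> is \<open>b \<cdot> a\<close> and \<open>star st b a\<close> is \<open>b \<star> a\<close>. The kernel of \<open>p\<close> is identified with \<open>A\<close>
  along \<open>i\<close>.\<close>

definition derived_actions ::
  "('w, 's) gwo_theory \<Rightarrow> ('u, 'w, 's) gwo \<Rightarrow> ('u, 'w, 's) gwo \<Rightarrow>
   ('u \<Rightarrow> 'u \<Rightarrow> 'u) \<Rightarrow> ('s \<Rightarrow> 'u \<Rightarrow> 'u \<Rightarrow> 'u) \<Rightarrow> bool" where
  "derived_actions T B A dot star \<longleftrightarrow>
    (\<exists>(E :: ('u, 'w, 's) gwo) i p s. split_extension T A E B i p s \<and>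
      (\<forall>b\<in>carrier B. \<forall>a\<in>carrier A. dot b a \<in> carrier A \<and>
         i (dot b a) = s b \<otimes>\<^bsub>E\<^esub> i a \<otimes>\<^bsub>E\<^esub> inv\<^bsub>E\<^esub> (s b)) \<and>
      (\<forall>st\<in>binary T. \<forall>b\<in>carrier B. \<forall>a\<in>carrier A. star st b a \<in> carrier A \<and>
         i (star st b a) = bop E st (s b) (i a)))"

record ('u, 'w, 's) xmod =
  xA :: "('u, 'w, 's) gwo"
  xB :: "('u, 'w, 's) gwo"
  xdot :: "'u \<Rightarrow> 'u \<Rightarrow> 'u"
  xstar :: "'s \<Rightarrow> 'u \<Rightarrow> 'u \<Rightarrow> 'u"
  xalpha :: "'u \<Rightarrow> 'u"

text \<open>In the last condition, \<open>a \<star> b\<close> for \<open>a \<in> A\<close>, \<open>b \<in> B\<close> stands for \<open>b \<star>\<^sup>\<circ> a\<close>.\<close>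

definition crossed_module :: "('w, 's) gwo_theory \<Rightarrow> ('u, 'w, 's) xmod \<Rightarrow> bool" where
  "crossed_module T X \<longleftrightarrow>
    (let A = xA X; B = xB X; dot = xdot X; star = xstar X; \<alpha> = xalpha X in
      gwo_obj T A \<and> gwo_obj T B \<and> derived_actions T B A dot star \<and> \<alpha> \<in> gwo_hom T A B \<and>
      (\<forall>b\<in>carrier B. \<forall>a\<in>carrier A. \<alpha> (dot b a) = b \<otimes>\<^bsub>B\<^esub> \<alpha> a \<otimes>\<^bsub>B\<^esub> inv\<^bsub>B\<^esub> b) \<and>
      (\<forall>a\<in>carrier A. \<forall>a'\<in>carrier A. dot (\<alpha> a) a' = a \<otimes>\<^bsub>A\<^esub> a' \<otimes>\<^bsub>A\<^esub> inv\<^bsub>A\<^esub> a) \<and>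
      (\<forall>st\<in>binary T. \<forall>a\<in>carrier A. \<forall>a'\<in>carrier A. star st (\<alpha> a) a' = bop A st a a') \<and>
      (\<forall>st\<in>binary T. \<forall>b\<in>carrier B. \<forall>a\<in>carrier A.
         \<alpha> (star st b a) = bop B st b (\<alpha> a) \<and>
         \<alpha> (star (opp T st) b a) = bop B st (\<alpha> a) b))"

definition xmod_hom ::
  "('w, 's) gwo_theory \<Rightarrow> ('u, 'w, 's) xmod \<Rightarrow> ('u, 'w, 's) xmod \<Rightarrow>
   (('u \<Rightarrow> 'u) \<times> ('u \<Rightarrow> 'u)) set" where
  "xmod_hom T X Y = {(f, g). f \<in> gwo_hom T (xA X) (xA Y) \<and> g \<in> gwo_hom T (xB X) (xB Y) \<and>
    (\<forall>a\<in>carrier (xA X). g (xalpha X a) = xalpha Y (f a)) \<and>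
    (\<forall>b\<in>carrier (xB X). \<forall>a\<in>carrier (xA X). f (xdot X b a) = xdot Y (g b) (f a)) \<and>
    (\<forall>st\<in>binary T. \<forall>b\<in>carrier (xB X). \<forall>a\<in>carrier (xA X).
       f (xstar X st b a) = xstar Y st (g b) (f a))}"

definition XMod ::
  "('w, 's) gwo_theory \<Rightarrow> (('u, 'w, 's) xmod, ('u \<Rightarrow> 'u) \<times> ('u \<Rightarrow> 'u)) cat" where
  "XMod T = \<lparr>
     Obj = {X. crossed_module T X},
     Hom = xmod_hom T,
     Ident = (\<lambda>X. (restrict (\<lambda>a. a) (carrier (xA X)), restrict (\<lambda>b. b) (carrier (xB X)))),
     Comp = (\<lambda>X Y Z (f', g') (f, g).
       (compose (carrier (xA X)) f' f, compose (carrier (xB X)) g' g)) \<rparr>"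


section \<open>Cat1-groups with operations\<close>

record ('u, 'w, 's) cat1 =
  cA :: "('u, 'w, 's) gwo"
  cs :: "'u \<Rightarrow> 'u"
  ct :: "'u \<Rightarrow> 'u"

definition cat1_group :: "('w, 's) gwo_theory \<Rightarrow> ('u, 'w, 's) cat1 \<Rightarrow> bool" where
  "cat1_group T X \<longleftrightarrow>
    (let A = cA X; s = cs X; t = ct X in
      gwo_obj T A \<and> s \<in> gwo_hom T A A \<and> t \<in> gwo_hom T A A \<and>
      (\<forall>x\<in>carrier A. s (t x) = t x \<and> t (s x) = s x) \<and>
      (\<forall>x\<in>kernel A A s. \<forall>y\<in>kernel A A t. x \<otimes>\<^bsub>A\<^esub> y = y \<otimes>\<^bsub>A\<^esub> x) \<and>
      (\<forall>st\<in>binary T. \<forall>x\<in>kernel A A s. \<forall>y\<in>kernel A A t. bop A st x y = \<one>\<^bsub>A\<^esub>))"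

definition cat1_hom ::
  "('w, 's) gwo_theory \<Rightarrow> ('u, 'w, 's) cat1 \<Rightarrow> ('u, 'w, 's) cat1 \<Rightarrow> ('u \<Rightarrow> 'u) set" where
  "cat1_hom T X Y = {f \<in> gwo_hom T (cA X) (cA Y).
    \<forall>x\<in>carrier (cA X). f (cs X x) = cs Y (f x) \<and> f (ct X x) = ct Y (f x)}"

definition Cat1 :: "('w, 's) gwo_theory \<Rightarrow> (('u, 'w, 's) cat1, 'u \<Rightarrow> 'u) cat" where
  "Cat1 T = \<lparr>
     Obj = {X. cat1_group T X},
     Hom = cat1_hom T,
     Ident = (\<lambda>X. restrict (\<lambda>x. x) (carrier (cA X))),
     Comp = (\<lambda>X Y Z g f. compose (carrier (cA X)) g f) \<rparr>"

end

theory Submission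
  imports Defs
begin

text \<open>
  Explanations use the additive notation of the subject; formulas write \<open>+\<close>, \<open>0\<close>, \<open>-\<close> as
  \<open>\<otimes>\<close>, \<open>\<one>\<close>, \<open>inv\<close>.

  A crossed module \<open>\<alpha> : A \<rightarrow> B\<close> is sent to the semidirect product \<open>A \<rtimes> B\<close> with
  \<open>s (a, b) = (0, b)\<close> and \<open>t (a, b) = (0, \<alpha> a + b)\<close>; a cat1-group \<open>(G, s, t)\<close> is sent to the
  restriction of \<open>t\<close> to \<open>ker s \<rightarrow> im s\<close>, on which \<open>im s\<close> acts inside \<open>G\<close>. These assignments are
  mutually inverse up to the isomorphisms \<open>a \<mapsto> (a, 0)\<close>, \<open>b \<mapsto> (0, b)\<close> and \<open>(a, b) \<mapsto> a + b\<close>.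

  The equivariance of \<open>\<alpha>\<close> says exactly that \<open>t\<close> is a morphism on \<open>A \<rtimes> B\<close> (\<open>ct_hom\<close>). The other
  two crossed module conditions (those of Peiffer type) say exactly that \<open>ker s = {(a, 0)}\<close> and
  \<open>ker t = {(a, - \<alpha> a)}\<close> commute and have zero products (\<open>cat1_of_cat1_group\<close>). In the opposite
  direction, \<open>- a + t a\<close> lies in \<open>ker t\<close> for every \<open>a\<close>; it therefore commutes with \<open>ker s\<close> and
  annihilates it, so that \<open>t a\<close> and \<open>a\<close> act on \<open>ker s\<close> in the same way (\<open>peiffer\<close>,
  \<open>peiffer_bop\<close>).

  The identities of the theory are arbitrary, so they cannot be checked on \<open>A \<rtimes> B\<close> by
  calculation. Instead, a derived action comes from some split extension \<open>E\<close> of \<open>B\<close> by \<open>A\<close>, and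
  \<open>(a, b) \<mapsto> i a + s b\<close> is a bijection onto \<open>E\<close> compatible with all operations
  (\<open>to_extension_bij\<close>, \<open>to_extension_hom\<close>). The formulas for the operations on \<open>A \<rtimes> B\<close> only
  mention the actions, hence they do not depend on the choice of \<open>E\<close>. Conversely, for a cat1-group
  the extension can be taken to be \<open>G\<close> itself, and then the same bijection is the isomorphism
  \<open>(a, b) \<mapsto> a + b\<close> above (\<open>counit_isomorphism\<close>).
\<close>

section \<open>Objects and morphisms\<close>

lemma gwo_homI:
  assumes "f \<in> extensional (carrier A)"
    and "\<And>x. x \<in> carrier A \<Longrightarrow> f x \<in> carrier B"
    and "\<And>x y. x \<in> carrier A \<Longrightarrow> y \<in> carrier A \<Longrightarrow> f (x \<otimes>\<^bsub>A\<^esub> y) = f x \<otimes>\<^bsub>B\<^esub> f y"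
    and "\<And>w x. w \<in> unary T \<Longrightarrow> x \<in> carrier A \<Longrightarrow> f (uop A w x) = uop B w (f x)"
    and "\<And>st x y. st \<in> binary T \<Longrightarrow> x \<in> carrier A \<Longrightarrow> y \<in> carrier A \<Longrightarrow>
      f (bop A st x y) = bop B st (f x) (f y)"
  shows "f \<in> gwo_hom T A B"
  using assms by (auto simp: gwo_hom_def hom_def)

lemma
  assumes "f \<in> gwo_hom T A B"
  shows gwo_hom_extensional: "f \<in> extensional (carrier A)"
    and gwo_hom_closed: "x \<in> carrier A \<Longrightarrow> f x \<in> carrier B"
    and gwo_hom_mult: "x \<in> carrier A \<Longrightarrow> y \<in> carrier A \<Longrightarrow> f (x \<otimes>\<^bsub>A\<^esub> y) = f x \<otimes>\<^bsub>B\<^esub> f y"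
    and gwo_hom_uop: "w \<in> unary T \<Longrightarrow> x \<in> carrier A \<Longrightarrow> f (uop A w x) = uop B w (f x)"
    and gwo_hom_bop: "st \<in> binary T \<Longrightarrow> x \<in> carrier A \<Longrightarrow> y \<in> carrier A \<Longrightarrow>
      f (bop A st x y) = bop B st (f x) (f y)"
  using assms by (auto simp: gwo_hom_def hom_def)

lemma
  assumes "gwo_obj T A"
  shows gwo_obj_group: "group A"
    and gwo_obj_uop_closed: "w \<in> unary T \<Longrightarrow> x \<in> carrier A \<Longrightarrow> uop A w x \<in> carrier A"
    and gwo_obj_bop_closed: "st \<in> binary T \<Longrightarrow> x \<in> carrier A \<Longrightarrow> y \<in> carrier A \<Longrightarrow>
      bop A st x y \<in> carrier A"
    and gwo_obj_identity: "(l, r) \<in> identities T \<Longrightarrow> range v \<subseteq> carrier A \<Longrightarrow> eval A v l = eval A v r"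
  using assms by (auto simp: gwo_obj_def)

lemma gwo_hom_group_hom:
  assumes "f \<in> gwo_hom T A B" "gwo_obj T A" "gwo_obj T B"
  shows "group_hom A B f"
  using assms by (auto simp: group_hom_def group_hom_axioms_def gwo_hom_def gwo_obj_def)

lemma
  assumes "f \<in> gwo_hom T A B" "gwo_obj T A" "gwo_obj T B"
  shows gwo_hom_one: "f \<one>\<^bsub>A\<^esub> = \<one>\<^bsub>B\<^esub>"
    and gwo_hom_inv: "x \<in> carrier A \<Longrightarrow> f (inv\<^bsub>A\<^esub> x) = inv\<^bsub>B\<^esub> (f x)"
  using gwo_hom_group_hom[OF assms] by (auto simp: group_hom.hom_one group_hom.hom_inv)

lemma gwo_hom_id:
  assumes "gwo_obj T A"
  shows "restrict (\<lambda>x. x) (carrier A) \<in> gwo_hom T A A"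
proof -
  interpret A: group A using assms by (rule gwo_obj_group)
  show ?thesis
    by (rule gwo_homI) (auto simp: gwo_obj_uop_closed[OF assms] gwo_obj_bop_closed[OF assms])
qed

lemma gwo_hom_compose:
  assumes "gwo_obj T A" "f \<in> gwo_hom T A B" "g \<in> gwo_hom T B C"
  shows "compose (carrier A) g f \<in> gwo_hom T A C"
proof -
  interpret A: group A using assms(1) by (rule gwo_obj_group)
  show ?thesis
    by (rule gwo_homI)
      (auto simp: compose_eq gwo_hom_closed[OF assms(2)] gwo_hom_mult[OF assms(2)]
        gwo_hom_uop[OF assms(2)] gwo_hom_bop[OF assms(2)] gwo_hom_closed[OF assms(3)]
        gwo_hom_mult[OF assms(3)] gwo_hom_uop[OF assms(3)] gwo_hom_bop[OF assms(3)]
        gwo_obj_uop_closed[OF assms(1)] gwo_obj_bop_closed[OF assms(1)])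
qed

abbreviation gwo_inverse ::
  "('u, 'w, 's) gwo \<Rightarrow> ('u, 'w, 's) gwo \<Rightarrow> ('u \<Rightarrow> 'u) \<Rightarrow> 'u \<Rightarrow> 'u" where
  "gwo_inverse A B f \<equiv> restrict (inv_into (carrier A) f) (carrier B)"

lemma
  assumes "bij_betw f (carrier A) (carrier B)"
  shows gwo_inverse_closed: "y \<in> carrier B \<Longrightarrow> gwo_inverse A B f y \<in> carrier A"
    and gwo_inverse_right: "y \<in> carrier B \<Longrightarrow> f (gwo_inverse A B f y) = y"
    and gwo_inverse_left: "x \<in> carrier A \<Longrightarrow> gwo_inverse A B f (f x) = x"
  using assms by (auto simp: bij_betw_def inv_into_into f_inv_into_f)

lemma gwo_inverse_hom:
  assumes A: "gwo_obj T A" and f: "f \<in> gwo_hom T A B" and bij: "bij_betw f (carrier A) (carrier B)"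
  shows "gwo_inverse A B f \<in> gwo_hom T B A"
proof -
  interpret A: group A using A by (rule gwo_obj_group)
  note [simp] = gwo_inverse_closed[OF bij] gwo_inverse_right[OF bij] gwo_inverse_left[OF bij]
  show ?thesis
  proof (rule gwo_homI)
    fix x y assume xy: "x \<in> carrier B" "y \<in> carrier B"
    have "f (gwo_inverse A B f x \<otimes>\<^bsub>A\<^esub> gwo_inverse A B f y) = x \<otimes>\<^bsub>B\<^esub> y"
      using xy gwo_inverse_closed[OF bij] gwo_inverse_right[OF bij] by (simp only: gwo_hom_mult[OF f])
    then show "gwo_inverse A B f (x \<otimes>\<^bsub>B\<^esub> y) = gwo_inverse A B f x \<otimes>\<^bsub>A\<^esub> gwo_inverse A B f y"
      using xy by (metis A.m_closed gwo_inverse_closed[OF bij] gwo_inverse_left[OF bij])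
  next
    fix w x assume xy: "w \<in> unary T" "x \<in> carrier B"
    have "f (uop A w (gwo_inverse A B f x)) = uop B w x"
      using xy gwo_inverse_closed[OF bij] gwo_inverse_right[OF bij] by (simp only: gwo_hom_uop[OF f])
    then show "gwo_inverse A B f (uop B w x) = uop A w (gwo_inverse A B f x)"
      using xy by (metis gwo_obj_uop_closed[OF A] gwo_inverse_closed[OF bij] gwo_inverse_left[OF bij])
  next
    fix st x y assume xy: "st \<in> binary T" "x \<in> carrier B" "y \<in> carrier B"
    have "f (bop A st (gwo_inverse A B f x) (gwo_inverse A B f y)) = bop B st x y"
      using xy gwo_inverse_closed[OF bij] gwo_inverse_right[OF bij] by (simp only: gwo_hom_bop[OF f])
    then show "gwo_inverse A B f (bop B st x y)
        = bop A st (gwo_inverse A B f x) (gwo_inverse A B f y)"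
      using xy by (metis gwo_obj_bop_closed[OF A] gwo_inverse_closed[OF bij] gwo_inverse_left[OF bij])
  qed (use gwo_inverse_closed[OF bij] in auto)
qed

locale operations_theory =
  fixes T :: "('w, 's) gwo_theory"
  assumes T: "groups_with_operations T"
begin

lemma opp_closed: "st \<in> binary T \<Longrightarrow> opp T st \<in> binary T"
  using T by (auto simp: groups_with_operations_def)

lemma bop_opp:
  assumes "gwo_obj T A" "st \<in> binary T" "x \<in> carrier A" "y \<in> carrier A"
  shows "bop A (opp T st) x y = bop A st y x"
proof -
  have "(TBin (opp T st) (TVar 0) (TVar 1), TBin st (TVar 1) (TVar 0)) \<in> identities T"
    using T assms by (auto simp: groups_with_operations_def)
  from gwo_obj_identity[OF assms(1) this, of "\<lambda>n. if n = 0 then x else y"] assms show ?thesis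
    by auto
qed

lemma bop_distrib_left:
  assumes "gwo_obj T A" "st \<in> binary T" "x \<in> carrier A" "y \<in> carrier A" "z \<in> carrier A"
  shows "bop A st x (y \<otimes>\<^bsub>A\<^esub> z) = bop A st x y \<otimes>\<^bsub>A\<^esub> bop A st x z"
proof -
  have "(TBin st (TVar 0) (TAdd (TVar 1) (TVar 2)),
        TAdd (TBin st (TVar 0) (TVar 1)) (TBin st (TVar 0) (TVar 2))) \<in> identities T"
    using T assms by (auto simp: groups_with_operations_def)
  from gwo_obj_identity[OF assms(1) this, of "\<lambda>n. if n = 0 then x else if n = 1 then y else z"]
    assms show ?thesis
    by auto
qed

lemma bop_distrib_right:
  assumes "gwo_obj T A" "st \<in> binary T" "x \<in> carrier A" "y \<in> carrier A" "z \<in> carrier A"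
  shows "bop A st (x \<otimes>\<^bsub>A\<^esub> y) z = bop A st x z \<otimes>\<^bsub>A\<^esub> bop A st y z"
proof -
  interpret A: group A using assms(1) by (rule gwo_obj_group)
  show ?thesis
    using bop_distrib_left[OF assms(1) opp_closed, of st z x y] assms
    by (simp add: bop_opp)
qed

lemma uop_distrib:
  assumes "gwo_obj T A" "w \<in> unary T" "x \<in> carrier A" "y \<in> carrier A"
  shows "uop A w (x \<otimes>\<^bsub>A\<^esub> y) = uop A w x \<otimes>\<^bsub>A\<^esub> uop A w y"
proof -
  have "(TUn w (TAdd (TVar 0) (TVar 1)), TAdd (TUn w (TVar 0)) (TUn w (TVar 1))) \<in> identities T"
    using T assms by (auto simp: groups_with_operations_def)
  from gwo_obj_identity[OF assms(1) this, of "\<lambda>n. if n = 0 then x else y"]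
    assms show ?thesis
    by auto
qed

lemma uop_one:
  assumes "gwo_obj T A" "w \<in> unary T"
  shows "uop A w \<one>\<^bsub>A\<^esub> = \<one>\<^bsub>A\<^esub>"
proof -
  interpret A: group A using assms(1) by (rule gwo_obj_group)
  show ?thesis
    using uop_distrib[OF assms, of "\<one>\<^bsub>A\<^esub>" "\<one>\<^bsub>A\<^esub>"] gwo_obj_uop_closed[OF assms, of "\<one>\<^bsub>A\<^esub>"]
    by (metis A.l_cancel_one' A.one_closed A.r_one)
qed

lemma bop_one_right:
  assumes "gwo_obj T A" "st \<in> binary T" "x \<in> carrier A"
  shows "bop A st x \<one>\<^bsub>A\<^esub> = \<one>\<^bsub>A\<^esub>"
proof -
  interpret A: group A using assms(1) by (rule gwo_obj_group)
  show ?thesis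
    using bop_distrib_left[OF assms, of "\<one>\<^bsub>A\<^esub>" "\<one>\<^bsub>A\<^esub>"] gwo_obj_bop_closed[OF assms, of "\<one>\<^bsub>A\<^esub>"]
    by (metis A.l_cancel_one' A.one_closed A.r_one)
qed

lemma bop_one_left:
  assumes "gwo_obj T A" "st \<in> binary T" "x \<in> carrier A"
  shows "bop A st \<one>\<^bsub>A\<^esub> x = \<one>\<^bsub>A\<^esub>"
proof -
  interpret A: group A using assms(1) by (rule gwo_obj_group)
  show ?thesis
    using bop_one_right[OF assms(1) opp_closed, of st x] assms by (simp add: bop_opp)
qed

lemma bop_inv_right:
  assumes "gwo_obj T A" "st \<in> binary T" "x \<in> carrier A" "y \<in> carrier A"
  shows "bop A st x y \<otimes>\<^bsub>A\<^esub> bop A st x (inv\<^bsub>A\<^esub> y) = \<one>\<^bsub>A\<^esub>"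
proof -
  interpret A: group A using assms(1) by (rule gwo_obj_group)
  show ?thesis
    using bop_distrib_left[OF assms, of "inv\<^bsub>A\<^esub> y"] assms by (simp add: bop_one_right)
qed

text \<open>An identity holds in \<open>M\<close> as soon as it holds in \<open>E\<close>, because evaluation commutes with the
  embedding \<open>\<phi>\<close>. This is the only way in which the unspecified identities of the theory are
  ever verified: subobjects embed by inclusion, and semidirect products embed in the middle term of
  a split extension. Inverses in \<open>M\<close> make sense only once \<open>M\<close> is known to be a group, so closure
  under inversion is expressed in \<open>E\<close>.\<close>

lemma gwo_obj_embedding:
  assumes E: "gwo_obj T E"
    and inj: "inj_on \<phi> (carrier M)"
    and \<phi>_closed: "\<And>x. x \<in> carrier M \<Longrightarrow> \<phi> x \<in> carrier E"
    and one_closed: "\<one>\<^bsub>M\<^esub> \<in> carrier M"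
    and mult_closed: "\<And>x y. x \<in> carrier M \<Longrightarrow> y \<in> carrier M \<Longrightarrow> x \<otimes>\<^bsub>M\<^esub> y \<in> carrier M"
    and uop_closed: "\<And>w x. w \<in> unary T \<Longrightarrow> x \<in> carrier M \<Longrightarrow> uop M w x \<in> carrier M"
    and bop_closed: "\<And>st x y. st \<in> binary T \<Longrightarrow> x \<in> carrier M \<Longrightarrow> y \<in> carrier M \<Longrightarrow>
      bop M st x y \<in> carrier M"
    and \<phi>_one: "\<phi> \<one>\<^bsub>M\<^esub> = \<one>\<^bsub>E\<^esub>"
    and \<phi>_mult: "\<And>x y. x \<in> carrier M \<Longrightarrow> y \<in> carrier M \<Longrightarrow> \<phi> (x \<otimes>\<^bsub>M\<^esub> y) = \<phi> x \<otimes>\<^bsub>E\<^esub> \<phi> y"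
    and \<phi>_uop: "\<And>w x. w \<in> unary T \<Longrightarrow> x \<in> carrier M \<Longrightarrow> \<phi> (uop M w x) = uop E w (\<phi> x)"
    and \<phi>_bop: "\<And>st x y. st \<in> binary T \<Longrightarrow> x \<in> carrier M \<Longrightarrow> y \<in> carrier M \<Longrightarrow>
      \<phi> (bop M st x y) = bop E st (\<phi> x) (\<phi> y)"
    and inverse: "\<And>x. x \<in> carrier M \<Longrightarrow> inv\<^bsub>E\<^esub> (\<phi> x) \<in> \<phi> ` carrier M"
  shows "gwo_obj T M"
proof -
  interpret E: group E using E by (rule gwo_obj_group)
  have cancel: "x = y" if "\<phi> x = \<phi> y" "x \<in> carrier M" "y \<in> carrier M" for x y
    using inj that by (auto dest: inj_onD)
  interpret M: group M
  proof (rule groupI)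
    fix x assume x: "x \<in> carrier M"
    obtain y where y: "y \<in> carrier M" "\<phi> y = inv\<^bsub>E\<^esub> (\<phi> x)"
      using inverse[OF x] by auto
    then have "y \<otimes>\<^bsub>M\<^esub> x = \<one>\<^bsub>M\<^esub>"
      using x by (intro cancel) (auto simp: one_closed mult_closed \<phi>_one \<phi>_mult \<phi>_closed)
    then show "\<exists>y\<in>carrier M. y \<otimes>\<^bsub>M\<^esub> x = \<one>\<^bsub>M\<^esub>"
      using y by auto
  qed (auto intro!: cancel simp: one_closed mult_closed \<phi>_one \<phi>_mult \<phi>_closed E.m_assoc)
  have \<phi>_inv: "\<phi> (inv\<^bsub>M\<^esub> x) = inv\<^bsub>E\<^esub> (\<phi> x)" if "x \<in> carrier M" for x
    using that \<phi>_mult[of "inv\<^bsub>M\<^esub> x" x] by (simp add: \<phi>_one \<phi>_closed E.inv_equality)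
  have eval: "eval M v u \<in> carrier M \<and> \<phi> (eval M v u) = eval E (\<phi> \<circ> v) u"
    if "usyms u \<subseteq> unary T" "bsyms u \<subseteq> binary T" "range v \<subseteq> carrier M" for u v
    using that
    by (induction u) (auto simp: \<phi>_one \<phi>_inv \<phi>_mult \<phi>_uop \<phi>_bop uop_closed bop_closed)
  have "eval M v l = eval M v r" if lr: "(l, r) \<in> identities T" and v: "range v \<subseteq> carrier M" for l r v
  proof (rule cancel)
    have syms: "usyms l \<subseteq> unary T" "bsyms l \<subseteq> binary T" "usyms r \<subseteq> unary T" "bsyms r \<subseteq> binary T"
      using lr T by (auto simp: groups_with_operations_def)
    have "eval E (\<phi> \<circ> v) l = eval E (\<phi> \<circ> v) r"
      using v \<phi>_closed by (intro gwo_obj_identity[OF E lr]) auto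
    with eval[OF syms(1,2) v] eval[OF syms(3,4) v]
    show "\<phi> (eval M v l) = \<phi> (eval M v r)" "eval M v l \<in> carrier M" "eval M v r \<in> carrier M"
      by auto
  qed
  then show ?thesis
    using M.is_group uop_closed bop_closed by (auto simp: gwo_obj_def)
qed

end

section \<open>Subobjects\<close>

definition subobject :: "('u, 'w, 's) gwo \<Rightarrow> 'u set \<Rightarrow> ('u, 'w, 's) gwo" where
  "subobject G S = G\<lparr>carrier := S\<rparr>"

lemma subobject_simps [simp]:
  "carrier (subobject G S) = S"
  "x \<otimes>\<^bsub>subobject G S\<^esub> y = x \<otimes>\<^bsub>G\<^esub> y"
  "\<one>\<^bsub>subobject G S\<^esub> = \<one>\<^bsub>G\<^esub>"
  "uop (subobject G S) = uop G"
  "bop (subobject G S) = bop G"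
  by (simp_all add: subobject_def)

context operations_theory
begin

lemma subobject_obj:
  assumes G: "gwo_obj T G" and S: "subgroup S G"
    and "\<And>w x. w \<in> unary T \<Longrightarrow> x \<in> S \<Longrightarrow> uop G w x \<in> S"
    and "\<And>st x y. st \<in> binary T \<Longrightarrow> x \<in> S \<Longrightarrow> y \<in> S \<Longrightarrow> bop G st x y \<in> S"
  shows "gwo_obj T (subobject G S)"
  by (rule gwo_obj_embedding[OF G, of "\<lambda>x. x"])
    (use assms in \<open>auto simp: subgroup.mem_carrier subgroup.m_closed subgroup.one_closed
      subgroup.m_inv_closed\<close>)

lemma subobject_inv:
  assumes "gwo_obj T G" "subgroup S G" "x \<in> S"
  shows "inv\<^bsub>subobject G S\<^esub> x = inv\<^bsub>G\<^esub> x"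
proof -
  interpret G: group G using assms(1) by (rule gwo_obj_group)
  interpret S: group "G\<lparr>carrier := S\<rparr>" using assms(2) by (rule subgroup.subgroup_is_group) (rule G.is_group)
  show ?thesis
    unfolding subobject_def
    by (rule S.inv_equality) (use assms in \<open>auto simp: subgroup.m_inv_closed subgroup.mem_carrier\<close>)
qed

lemma kernel_subobject_obj:
  assumes G: "gwo_obj T G" and H: "gwo_obj T H" and f: "f \<in> gwo_hom T G H"
  shows "gwo_obj T (subobject G (kernel G H f))"
proof -
  interpret H: group H using H by (rule gwo_obj_group)
  show ?thesis
    by (rule subobject_obj[OF G])
      (use group_hom.subgroup_kernel[OF gwo_hom_group_hom[OF f G H]] in
        \<open>auto simp: kernel_def gwo_obj_uop_closed[OF G] gwo_obj_bop_closed[OF G] gwo_hom_uop[OF f]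
          gwo_hom_bop[OF f] uop_one[OF H] bop_one_right[OF H]\<close>)
qed

lemma image_subobject_obj:
  assumes G: "gwo_obj T G" and H: "gwo_obj T H" and f: "f \<in> gwo_hom T G H"
  shows "gwo_obj T (subobject H (f ` carrier G))"
proof (rule subobject_obj[OF H])
  show "subgroup (f ` carrier G) H"
    by (rule group_hom.img_is_subgroup[OF gwo_hom_group_hom[OF f G H]])
  show "uop H w x \<in> f ` carrier G" if "w \<in> unary T" "x \<in> f ` carrier G" for w x
    using that by (auto simp: gwo_obj_uop_closed[OF G] simp flip: gwo_hom_uop[OF f])
  show "bop H st x y \<in> f ` carrier G"
    if "st \<in> binary T" "x \<in> f ` carrier G" "y \<in> f ` carrier G" for st x y
    using that by (auto simp: gwo_obj_bop_closed[OF G] simp flip: gwo_hom_bop[OF f])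
qed

end

section \<open>Semidirect products\<close>

text \<open>All carriers are subsets of one type \<open>'u\<close>. An injection \<open>pair\<close> of \<open>'u \<times> 'u\<close> into \<open>'u\<close>
  allows a semidirect product of two objects to live in that same type.\<close>

locale paired_operations_theory = operations_theory T for T :: "('w, 's) gwo_theory" +
  fixes pair :: "'u \<times> 'u \<Rightarrow> 'u"
  assumes inj_pair: "inj pair"
begin

abbreviation unpair :: "'u \<Rightarrow> 'u \<times> 'u" where
  "unpair \<equiv> inv_into UNIV pair"

lemma unpair_pair [simp]: "unpair (pair z) = z"
  using inj_pair by simp

lemma pair_eq_iff [simp]: "pair z = pair z' \<longleftrightarrow> z = z'"
  using inj_pair by (auto dest: injD)

text \<open>The operations are the ones obtained by expanding \<open>(a + b) + (a' + b')\<close>, \<open>\<omega> (a + b)\<close> and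
  \<open>(a + b) \<star> (a' + b')\<close> with the elements of \<open>A\<close> moved to the left. The mixed term \<open>a \<star> b'\<close> is
  by definition \<open>b' \<star>\<^sup>\<circ> a\<close>.\<close>

definition semidirect ::
  "('u, 'w, 's) gwo \<Rightarrow> ('u, 'w, 's) gwo \<Rightarrow> ('u \<Rightarrow> 'u \<Rightarrow> 'u) \<Rightarrow> ('s \<Rightarrow> 'u \<Rightarrow> 'u \<Rightarrow> 'u) \<Rightarrow>
   ('u, 'w, 's) gwo" where
  "semidirect A B dot star = \<lparr>
     carrier = pair ` (carrier A \<times> carrier B),
     mult = (\<lambda>z z'. case (unpair z, unpair z') of ((a, b), (a', b')) \<Rightarrow>
       pair (a \<otimes>\<^bsub>A\<^esub> dot b a', b \<otimes>\<^bsub>B\<^esub> b')),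
     one = pair (\<one>\<^bsub>A\<^esub>, \<one>\<^bsub>B\<^esub>),
     uop = (\<lambda>w z. case unpair z of (a, b) \<Rightarrow> pair (uop A w a, uop B w b)),
     bop = (\<lambda>st z z'. case (unpair z, unpair z') of ((a, b), (a', b')) \<Rightarrow>
       pair (bop A st a a' \<otimes>\<^bsub>A\<^esub> star (opp T st) b' a \<otimes>\<^bsub>A\<^esub> star st b a', bop B st b b')) \<rparr>"

lemma semidirect_simps [simp]:
  "carrier (semidirect A B dot star) = pair ` (carrier A \<times> carrier B)"
  "pair (a, b) \<otimes>\<^bsub>semidirect A B dot star\<^esub> pair (a', b') = pair (a \<otimes>\<^bsub>A\<^esub> dot b a', b \<otimes>\<^bsub>B\<^esub> b')"
  "\<one>\<^bsub>semidirect A B dot star\<^esub> = pair (\<one>\<^bsub>A\<^esub>, \<one>\<^bsub>B\<^esub>)"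
  "uop (semidirect A B dot star) w (pair (a, b)) = pair (uop A w a, uop B w b)"
  "bop (semidirect A B dot star) st (pair (a, b)) (pair (a', b')) =
    pair (bop A st a a' \<otimes>\<^bsub>A\<^esub> star (opp T st) b' a \<otimes>\<^bsub>A\<^esub> star st b a', bop B st b b')"
  by (simp_all add: semidirect_def)

end

text \<open>A derived action together with a chosen split extension that induces it. Equations between
  elements of \<open>A\<close> are proved by applying the injective \<open>i\<close> and calculating in \<open>E\<close>.\<close>

locale split_extension_actions = paired_operations_theory T pair
  for T :: "('w, 's) gwo_theory" and pair :: "'u \<times> 'u \<Rightarrow> 'u" +
  fixes A E B :: "('u, 'w, 's) gwo" and i p s and dot :: "'u \<Rightarrow> 'u \<Rightarrow> 'u"
    and star :: "'s \<Rightarrow> 'u \<Rightarrow> 'u \<Rightarrow> 'u"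
  assumes split: "split_extension T A E B i p s"
    and dot_closed: "\<And>b a. b \<in> carrier B \<Longrightarrow> a \<in> carrier A \<Longrightarrow> dot b a \<in> carrier A"
    and i_dot: "\<And>b a. b \<in> carrier B \<Longrightarrow> a \<in> carrier A \<Longrightarrow>
      i (dot b a) = s b \<otimes>\<^bsub>E\<^esub> i a \<otimes>\<^bsub>E\<^esub> inv\<^bsub>E\<^esub> (s b)"
    and star_closed: "\<And>st b a. st \<in> binary T \<Longrightarrow> b \<in> carrier B \<Longrightarrow> a \<in> carrier A \<Longrightarrow>
      star st b a \<in> carrier A"
    and i_star: "\<And>st b a. st \<in> binary T \<Longrightarrow> b \<in> carrier B \<Longrightarrow> a \<in> carrier A \<Longrightarrow>
      i (star st b a) = bop E st (s b) (i a)"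
begin

lemma
  shows A: "gwo_obj T A" and E: "gwo_obj T E" and B: "gwo_obj T B"
    and i: "i \<in> gwo_hom T A E" and p: "p \<in> gwo_hom T E B" and s: "s \<in> gwo_hom T B E"
    and inj_i: "inj_on i (carrier A)" and image_i: "i ` carrier A = kernel E B p"
    and p_s: "b \<in> carrier B \<Longrightarrow> p (s b) = b"
  using split by (auto simp: split_extension_def)

sublocale A: group A by (rule gwo_obj_group[OF A])
sublocale B: group B by (rule gwo_obj_group[OF B])
sublocale E: group E by (rule gwo_obj_group[OF E])

lemmas [simp] =
  gwo_hom_closed[OF i] gwo_hom_closed[OF s] gwo_hom_closed[OF p]
  gwo_hom_mult[OF i] gwo_hom_mult[OF s] gwo_hom_mult[OF p]
  gwo_hom_uop[OF i] gwo_hom_uop[OF s] gwo_hom_uop[OF p]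
  gwo_hom_bop[OF i] gwo_hom_bop[OF s] gwo_hom_bop[OF p]
  gwo_hom_one[OF i A E] gwo_hom_one[OF s B E] gwo_hom_one[OF p E B]
  gwo_hom_inv[OF i A E] gwo_hom_inv[OF s B E] gwo_hom_inv[OF p E B]
  gwo_obj_uop_closed[OF A] gwo_obj_uop_closed[OF E] gwo_obj_uop_closed[OF B]
  gwo_obj_bop_closed[OF A] gwo_obj_bop_closed[OF E] gwo_obj_bop_closed[OF B]
  dot_closed i_dot star_closed i_star p_s opp_closed

lemma i_cancel:
  assumes "i x = i y" "x \<in> carrier A" "y \<in> carrier A"
  shows "x = y"
  using assms inj_i by (auto dest: inj_onD)

lemma p_i [simp]: "a \<in> carrier A \<Longrightarrow> p (i a) = \<one>\<^bsub>B\<^esub>"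
  using image_i by (auto simp: kernel_def)

lemma dot_one_left: "a \<in> carrier A \<Longrightarrow> dot \<one>\<^bsub>B\<^esub> a = a"
  by (rule i_cancel) simp_all

lemma dot_one_right: "b \<in> carrier B \<Longrightarrow> dot b \<one>\<^bsub>A\<^esub> = \<one>\<^bsub>A\<^esub>"
  by (rule i_cancel) simp_all

lemma star_one_left: "st \<in> binary T \<Longrightarrow> a \<in> carrier A \<Longrightarrow> star st \<one>\<^bsub>B\<^esub> a = \<one>\<^bsub>A\<^esub>"
  by (rule i_cancel) (simp_all add: bop_one_left[OF E])

lemma star_one_right: "st \<in> binary T \<Longrightarrow> b \<in> carrier B \<Longrightarrow> star st b \<one>\<^bsub>A\<^esub> = \<one>\<^bsub>A\<^esub>"
  by (rule i_cancel) (simp_all add: bop_one_right[OF E])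

definition to_extension :: "'u \<Rightarrow> 'u" where
  "to_extension = restrict (\<lambda>z. case unpair z of (a, b) \<Rightarrow> i a \<otimes>\<^bsub>E\<^esub> s b)
     (carrier (semidirect A B dot star))"

lemma to_extension_pair [simp]:
  "a \<in> carrier A \<Longrightarrow> b \<in> carrier B \<Longrightarrow> to_extension (pair (a, b)) = i a \<otimes>\<^bsub>E\<^esub> s b"
  by (simp add: to_extension_def)

text \<open>Applying \<open>p\<close> to \<open>i a + s b\<close> recovers \<open>b\<close>, and then \<open>i a\<close> is determined as well.\<close>

lemma inj_to_extension: "inj_on to_extension (carrier (semidirect A B dot star))"
proof (rule inj_onI, clarsimp)
  fix a b a' b'
  assume carr: "a \<in> carrier A" "b \<in> carrier B" "a' \<in> carrier A" "b' \<in> carrier B"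
    and eq: "i a \<otimes>\<^bsub>E\<^esub> s b = i a' \<otimes>\<^bsub>E\<^esub> s b'"
  then have "p (i a \<otimes>\<^bsub>E\<^esub> s b) = p (i a' \<otimes>\<^bsub>E\<^esub> s b')"
    by simp
  with carr have "b = b'"
    by simp
  with eq carr show "a = a' \<and> b = b'"
    using i_cancel[of a a'] by simp
qed

text \<open>Every \<open>x\<close> is \<open>(x - s (p x)) + s (p x)\<close>, whose first summand lies in the kernel of \<open>p\<close>.\<close>

lemma surj_to_extension:
  assumes x: "x \<in> carrier E"
  shows "x \<in> to_extension ` carrier (semidirect A B dot star)"
proof -
  have "x \<otimes>\<^bsub>E\<^esub> inv\<^bsub>E\<^esub> (s (p x)) \<in> kernel E B p"
    using x by (simp add: kernel_def)
  then obtain a where a: "a \<in> carrier A" "i a = x \<otimes>\<^bsub>E\<^esub> inv\<^bsub>E\<^esub> (s (p x))"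
    using image_i by (metis imageE)
  with x have "to_extension (pair (a, p x)) = x"
    by (simp add: E.m_assoc)
  with a x show ?thesis
    by (intro image_eqI[of _ _ "pair (a, p x)"]) auto
qed

lemma to_extension_uop:
  "w \<in> unary T \<Longrightarrow> a \<in> carrier A \<Longrightarrow> b \<in> carrier B \<Longrightarrow>
   i (uop A w a) \<otimes>\<^bsub>E\<^esub> s (uop B w b) = uop E w (i a \<otimes>\<^bsub>E\<^esub> s b)"
  by (simp add: uop_distrib[OF E])

lemma to_extension_mult:
  assumes "a \<in> carrier A" "b \<in> carrier B" "a' \<in> carrier A" "b' \<in> carrier B"
  shows "i (a \<otimes>\<^bsub>A\<^esub> dot b a') \<otimes>\<^bsub>E\<^esub> s (b \<otimes>\<^bsub>B\<^esub> b') = (i a \<otimes>\<^bsub>E\<^esub> s b) \<otimes>\<^bsub>E\<^esub> (i a' \<otimes>\<^bsub>E\<^esub> s b')"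
proof -
  have "inv\<^bsub>E\<^esub> (s b) \<otimes>\<^bsub>E\<^esub> (s b \<otimes>\<^bsub>E\<^esub> s b') = s b'"
    using assms by (simp flip: E.m_assoc)
  with assms show ?thesis
    by (simp add: E.m_assoc)
qed

lemma to_extension_bop:
  assumes "st \<in> binary T" "a \<in> carrier A" "b \<in> carrier B" "a' \<in> carrier A" "b' \<in> carrier B"
  shows "i (bop A st a a' \<otimes>\<^bsub>A\<^esub> star (opp T st) b' a \<otimes>\<^bsub>A\<^esub> star st b a') \<otimes>\<^bsub>E\<^esub> s (bop B st b b')
    = bop E st (i a \<otimes>\<^bsub>E\<^esub> s b) (i a' \<otimes>\<^bsub>E\<^esub> s b')"
proof -
  \<comment> \<open>Expanding in the first argument before the second yields the four terms in the order
    in which the semidirect product lists them.\<close>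
  have "bop E st (i a \<otimes>\<^bsub>E\<^esub> s b) (i a' \<otimes>\<^bsub>E\<^esub> s b')
      = bop E st (i a) (i a' \<otimes>\<^bsub>E\<^esub> s b') \<otimes>\<^bsub>E\<^esub> bop E st (s b) (i a' \<otimes>\<^bsub>E\<^esub> s b')"
    using assms by (intro bop_distrib_right[OF E]) auto
  then show ?thesis
    using assms by (simp add: bop_distrib_left[OF E] bop_opp[OF E] E.m_assoc)
qed

lemma semidirect_obj: "gwo_obj T (semidirect A B dot star)"
  by (rule gwo_obj_embedding[OF E inj_to_extension])
    (auto simp del: gwo_hom_mult[OF i] gwo_hom_mult[OF s] gwo_hom_uop[OF i] gwo_hom_uop[OF s]
      gwo_hom_bop[OF i] gwo_hom_bop[OF s]
      simp: to_extension_uop to_extension_mult to_extension_bop intro!: surj_to_extension[simplified])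

lemma to_extension_hom: "to_extension \<in> gwo_hom T (semidirect A B dot star) E"
  by (rule gwo_homI)
    (auto simp del: gwo_hom_mult[OF i] gwo_hom_mult[OF s] gwo_hom_uop[OF i] gwo_hom_uop[OF s]
      gwo_hom_bop[OF i] gwo_hom_bop[OF s]
      simp: to_extension_uop to_extension_mult to_extension_bop, simp add: to_extension_def)

lemma to_extension_bij: "bij_betw to_extension (carrier (semidirect A B dot star)) (carrier E)"
  using inj_to_extension surj_to_extension gwo_hom_closed[OF to_extension_hom]
  by (auto simp: bij_betw_def simp del: semidirect_simps)

end

section \<open>The categories of crossed modules and of cat1-groups\<close>

locale crossed_mod = operations_theory T for T :: "('w, 's) gwo_theory" +
  fixes X :: "('u, 'w, 's) xmod"
  assumes X: "crossed_module T X"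
begin

abbreviation "A \<equiv> xA X"
abbreviation "B \<equiv> xB X"
abbreviation "dot \<equiv> xdot X"
abbreviation "star \<equiv> xstar X"
abbreviation "\<alpha> \<equiv> xalpha X"

lemma
  shows A: "gwo_obj T A" and B: "gwo_obj T B" and actions: "derived_actions T B A dot star"
    and \<alpha>: "\<alpha> \<in> gwo_hom T A B"
    and \<alpha>_dot: "b \<in> carrier B \<Longrightarrow> a \<in> carrier A \<Longrightarrow> \<alpha> (dot b a) = b \<otimes>\<^bsub>B\<^esub> \<alpha> a \<otimes>\<^bsub>B\<^esub> inv\<^bsub>B\<^esub> b"
    and dot_\<alpha>: "a \<in> carrier A \<Longrightarrow> a' \<in> carrier A \<Longrightarrow> dot (\<alpha> a) a' = a \<otimes>\<^bsub>A\<^esub> a' \<otimes>\<^bsub>A\<^esub> inv\<^bsub>A\<^esub> a"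
    and star_\<alpha>: "st \<in> binary T \<Longrightarrow> a \<in> carrier A \<Longrightarrow> a' \<in> carrier A \<Longrightarrow>
      star st (\<alpha> a) a' = bop A st a a'"
    and \<alpha>_star: "st \<in> binary T \<Longrightarrow> b \<in> carrier B \<Longrightarrow> a \<in> carrier A \<Longrightarrow>
      \<alpha> (star st b a) = bop B st b (\<alpha> a)"
    and \<alpha>_star_opp: "st \<in> binary T \<Longrightarrow> b \<in> carrier B \<Longrightarrow> a \<in> carrier A \<Longrightarrow>
      \<alpha> (star (opp T st) b a) = bop B st (\<alpha> a) b"
  using X by (auto simp: crossed_module_def Let_def)

lemma
  shows dot_closed: "b \<in> carrier B \<Longrightarrow> a \<in> carrier A \<Longrightarrow> dot b a \<in> carrier A"
    and star_closed: "st \<in> binary T \<Longrightarrow> b \<in> carrier B \<Longrightarrow> a \<in> carrier A \<Longrightarrow> star st b a \<in> carrier A"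
  using actions by (auto simp: derived_actions_def)

sublocale A: group A by (rule gwo_obj_group[OF A])
sublocale B: group B by (rule gwo_obj_group[OF B])

lemmas closed = dot_closed star_closed opp_closed gwo_hom_closed[OF \<alpha>]
  gwo_obj_uop_closed[OF A] gwo_obj_uop_closed[OF B]
  gwo_obj_bop_closed[OF A] gwo_obj_bop_closed[OF B]

end

lemma
  assumes "(f, g) \<in> xmod_hom T X Y"
  shows xmod_hom_fst: "f \<in> gwo_hom T (xA X) (xA Y)"
    and xmod_hom_snd: "g \<in> gwo_hom T (xB X) (xB Y)"
    and xmod_hom_alpha: "a \<in> carrier (xA X) \<Longrightarrow> g (xalpha X a) = xalpha Y (f a)"
    and xmod_hom_dot: "b \<in> carrier (xB X) \<Longrightarrow> a \<in> carrier (xA X) \<Longrightarrow>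
      f (xdot X b a) = xdot Y (g b) (f a)"
    and xmod_hom_star: "st \<in> binary T \<Longrightarrow> b \<in> carrier (xB X) \<Longrightarrow> a \<in> carrier (xA X) \<Longrightarrow>
      f (xstar X st b a) = xstar Y st (g b) (f a)"
  using assms by (auto simp: xmod_hom_def)

lemma compose_restrict_id:
  "f \<in> extensional A \<Longrightarrow> compose A f (restrict (\<lambda>x. x) A) = f"
  "f \<in> extensional A \<Longrightarrow> (\<And>x. x \<in> A \<Longrightarrow> f x \<in> B) \<Longrightarrow> compose A (restrict (\<lambda>x. x) B) f = f"
  by (auto simp: compose_def restrict_def extensional_def fun_eq_iff)

lemma compose_restrict_assoc:
  "(\<And>x. x \<in> A \<Longrightarrow> f x \<in> B) \<Longrightarrow> compose A (compose B h g) f = compose A h (compose A g f)"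
  by (auto simp: compose_def restrict_def fun_eq_iff)

context operations_theory
begin

lemma category_XMod: "category (XMod T :: (('u, 'w, 's) xmod, _) cat)"
proof -
  have ident: "(restrict (\<lambda>a. a) (carrier (xA X)), restrict (\<lambda>b. b) (carrier (xB X))) \<in> xmod_hom T X X"
    if "crossed_module T X" for X :: "('u, 'w, 's) xmod"
  proof -
    interpret crossed_mod T X by unfold_locales (rule that)
    show ?thesis
      by (simp add: xmod_hom_def gwo_hom_id[OF A] gwo_hom_id[OF B] closed)
  qed
  have comp: "(compose (carrier (xA X)) f' f, compose (carrier (xB X)) g' g) \<in> xmod_hom T X Z"
    if "crossed_module T X" and fg: "(f, g) \<in> xmod_hom T X Y" and fg': "(f', g') \<in> xmod_hom T Y Z"
    for X Y Z :: "('u, 'w, 's) xmod" and f g f' g'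
  proof -
    interpret crossed_mod T X by unfold_locales (rule that)
    note f = xmod_hom_fst[OF fg] and g = xmod_hom_snd[OF fg]
      and f' = xmod_hom_fst[OF fg'] and g' = xmod_hom_snd[OF fg']
    show ?thesis
      by (simp add: xmod_hom_def compose_eq gwo_hom_compose[OF A f f'] gwo_hom_compose[OF B g g'] closed
          gwo_hom_closed[OF f] gwo_hom_closed[OF g] xmod_hom_alpha[OF fg] xmod_hom_alpha[OF fg']
          xmod_hom_dot[OF fg] xmod_hom_dot[OF fg'] xmod_hom_star[OF fg] xmod_hom_star[OF fg'])
  qed
  show ?thesis
    unfolding category_def
  proof (intro conjI ballI)
    fix X assume "X \<in> Obj (XMod T :: (('u, 'w, 's) xmod, _) cat)"
    then show "Ident (XMod T) X \<in> Hom (XMod T) X X"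
      by (simp add: XMod_def ident)
  next
    fix X Y Z :: "('u, 'w, 's) xmod" and \<phi> \<psi>
    assume "X \<in> Obj (XMod T)" "\<phi> \<in> Hom (XMod T) X Y" "\<psi> \<in> Hom (XMod T) Y Z"
    then show "Comp (XMod T) X Y Z \<psi> \<phi> \<in> Hom (XMod T) X Z"
      by (cases \<phi>; cases \<psi>) (simp add: XMod_def comp)
  next
    fix X Y :: "('u, 'w, 's) xmod" and \<phi>
    assume "\<phi> \<in> Hom (XMod T) X Y"
    then show "Comp (XMod T) X X Y \<phi> (Ident (XMod T) X) = \<phi>"
      and "Comp (XMod T) X Y Y (Ident (XMod T) Y) \<phi> = \<phi>"
      by (cases \<phi>, simp add: XMod_def compose_restrict_id gwo_hom_extensional[OF xmod_hom_fst]
          gwo_hom_extensional[OF xmod_hom_snd] gwo_hom_closed[OF xmod_hom_fst]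
          gwo_hom_closed[OF xmod_hom_snd])+
  next
    fix W X Y Z :: "('u, 'w, 's) xmod" and \<phi> \<psi> \<chi>
    assume "\<phi> \<in> Hom (XMod T) W X"
    then show "Comp (XMod T) W X Z (Comp (XMod T) X Y Z \<chi> \<psi>) \<phi>
        = Comp (XMod T) W Y Z \<chi> (Comp (XMod T) W X Y \<psi> \<phi>)"
      by (cases \<phi>; cases \<psi>; cases \<chi>)
        (simp add: XMod_def compose_restrict_assoc gwo_hom_closed[OF xmod_hom_fst]
          gwo_hom_closed[OF xmod_hom_snd])
  qed
qed

end

locale cat1_gwo = operations_theory T for T :: "('w, 's) gwo_theory" +
  fixes C :: "('u, 'w, 's) cat1"
  assumes C: "cat1_group T C"
begin

abbreviation "G \<equiv> cA C"
abbreviation "s \<equiv> cs C"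
abbreviation "t \<equiv> ct C"

lemma
  shows G: "gwo_obj T G" and s: "s \<in> gwo_hom T G G" and t: "t \<in> gwo_hom T G G"
    and s_t: "x \<in> carrier G \<Longrightarrow> s (t x) = t x" and t_s: "x \<in> carrier G \<Longrightarrow> t (s x) = s x"
    and kernels_commute: "x \<in> kernel G G s \<Longrightarrow> y \<in> kernel G G t \<Longrightarrow> x \<otimes>\<^bsub>G\<^esub> y = y \<otimes>\<^bsub>G\<^esub> x"
    and kernels_bop: "st \<in> binary T \<Longrightarrow> x \<in> kernel G G s \<Longrightarrow> y \<in> kernel G G t \<Longrightarrow>
      bop G st x y = \<one>\<^bsub>G\<^esub>"
  using C by (auto simp: cat1_group_def Let_def)

sublocale G: group G by (rule gwo_obj_group[OF G])

end

lemma
  assumes "f \<in> cat1_hom T C D"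
  shows cat1_hom_gwo: "f \<in> gwo_hom T (cA C) (cA D)"
    and cat1_hom_s: "x \<in> carrier (cA C) \<Longrightarrow> f (cs C x) = cs D (f x)"
    and cat1_hom_t: "x \<in> carrier (cA C) \<Longrightarrow> f (ct C x) = ct D (f x)"
  using assms by (auto simp: cat1_hom_def)

context operations_theory
begin

lemma category_Cat1: "category (Cat1 T :: (('u, 'w, 's) cat1, _) cat)"
proof -
  have ident: "restrict (\<lambda>a. a) (carrier (cA C)) \<in> cat1_hom T C C"
    if "cat1_group T C" for C :: "('u, 'w, 's) cat1"
  proof -
    interpret cat1_gwo T C by unfold_locales (rule that)
    show ?thesis
      by (simp add: cat1_hom_def gwo_hom_id[OF G] gwo_hom_closed[OF s] gwo_hom_closed[OF t])
  qed
  have comp: "compose (carrier (cA C)) g f \<in> cat1_hom T C E"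
    if "cat1_group T C" and f: "f \<in> cat1_hom T C D" and g: "g \<in> cat1_hom T D E"
    for C D E :: "('u, 'w, 's) cat1" and f g
  proof -
    interpret cat1_gwo T C by unfold_locales (rule that)
    note f' = cat1_hom_gwo[OF f] and g' = cat1_hom_gwo[OF g]
    show ?thesis
      by (simp add: cat1_hom_def compose_eq gwo_hom_compose[OF G f' g'] gwo_hom_closed[OF f']
          gwo_hom_closed[OF s] gwo_hom_closed[OF t] cat1_hom_s[OF f] cat1_hom_s[OF g]
          cat1_hom_t[OF f] cat1_hom_t[OF g])
  qed
  show ?thesis
    unfolding category_def Cat1_def
    by (auto simp: ident compose_restrict_id compose_restrict_assoc
        gwo_hom_extensional[OF cat1_hom_gwo] gwo_hom_closed[OF cat1_hom_gwo] intro: comp)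
qed

text \<open>As for algebras, bijectivity suffices: the inverse maps respect \<open>\<alpha>\<close> and the actions because
  this can be checked after applying \<open>f\<close> and \<open>g\<close>.\<close>

lemma isomorphism_XModI:
  fixes X Y :: "('u, 'w, 's) xmod"
  assumes X: "crossed_module T X" and Y: "crossed_module T Y" and fg: "(f, g) \<in> xmod_hom T X Y"
    and f_bij: "bij_betw f (carrier (xA X)) (carrier (xA Y))"
    and g_bij: "bij_betw g (carrier (xB X)) (carrier (xB Y))"
  shows "isomorphism (XMod T) X Y (f, g)"
proof -
  interpret X: crossed_mod T X by unfold_locales (rule X)
  interpret Y: crossed_mod T Y by unfold_locales (rule Y)
  let ?f = "gwo_inverse X.A Y.A f" and ?g = "gwo_inverse X.B Y.B g"
  note closed = gwo_inverse_closed[OF f_bij] gwo_inverse_closed[OF g_bij]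
  note right = gwo_inverse_right[OF f_bij] gwo_inverse_right[OF g_bij]
  note left = gwo_inverse_left[OF f_bij] gwo_inverse_left[OF g_bij]
  have "?g (Y.\<alpha> a) = X.\<alpha> (?f a)" if "a \<in> carrier Y.A" for a
    using that left(2)[of "X.\<alpha> (?f a)"] closed right xmod_hom_alpha[OF fg, of "?f a"]
    by (simp add: X.closed del: restrict_apply restrict_apply')
  moreover have "?f (Y.dot b a) = X.dot (?g b) (?f a)" if "a \<in> carrier Y.A" "b \<in> carrier Y.B" for a b
    using that left(1)[of "X.dot (?g b) (?f a)"] closed right xmod_hom_dot[OF fg, of "?g b" "?f a"]
    by (simp add: X.closed del: restrict_apply restrict_apply')
  moreover have "?f (Y.star st b a) = X.star st (?g b) (?f a)"
    if "st \<in> binary T" "a \<in> carrier Y.A" "b \<in> carrier Y.B" for st a b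
    using that left(1)[of "X.star st (?g b) (?f a)"] closed right
      xmod_hom_star[OF fg that(1), of "?g b" "?f a"]
    by (simp add: X.closed del: restrict_apply restrict_apply')
  ultimately have "(?f, ?g) \<in> xmod_hom T Y X"
    using gwo_inverse_hom[OF X.A xmod_hom_fst[OF fg] f_bij]
      gwo_inverse_hom[OF X.B xmod_hom_snd[OF fg] g_bij]
    by (simp add: xmod_hom_def del: restrict_apply restrict_apply')
  moreover have "compose (carrier X.A) ?f f = restrict (\<lambda>x. x) (carrier X.A)"
    "compose (carrier X.B) ?g g = restrict (\<lambda>x. x) (carrier X.B)"
    "compose (carrier Y.A) f ?f = restrict (\<lambda>x. x) (carrier Y.A)"
    "compose (carrier Y.B) g ?g = restrict (\<lambda>x. x) (carrier Y.B)"
    using left right by (auto simp: compose_def intro!: restrict_ext simp del: restrict_apply restrict_apply')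
  ultimately show ?thesis
    unfolding isomorphism_def XMod_def using fg by (auto intro!: bexI[of _ "(?f, ?g)"])
qed

lemma isomorphism_Cat1I:
  fixes C D :: "('u, 'w, 's) cat1"
  assumes C: "cat1_group T C" and f: "f \<in> cat1_hom T C D"
    and bij: "bij_betw f (carrier (cA C)) (carrier (cA D))"
  shows "isomorphism (Cat1 T) C D f"
proof -
  interpret C: cat1_gwo T C by unfold_locales (rule C)
  let ?f = "gwo_inverse C.G (cA D) f"
  note closed = gwo_inverse_closed[OF bij] and right = gwo_inverse_right[OF bij]
    and left = gwo_inverse_left[OF bij]
  have "?f (cs D x) = C.s (?f x)" "?f (ct D x) = C.t (?f x)" if "x \<in> carrier (cA D)" for x
    using that left[of "C.s (?f x)"] left[of "C.t (?f x)"] closed right cat1_hom_s[OF f, of "?f x"]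
      cat1_hom_t[OF f, of "?f x"]
    by (simp_all add: gwo_hom_closed[OF C.s] gwo_hom_closed[OF C.t] del: restrict_apply restrict_apply')
  then have "?f \<in> cat1_hom T D C"
    using gwo_inverse_hom[OF C.G cat1_hom_gwo[OF f] bij]
    by (simp add: cat1_hom_def del: restrict_apply restrict_apply')
  moreover have "compose (carrier C.G) ?f f = restrict (\<lambda>x. x) (carrier C.G)"
    "compose (carrier (cA D)) f ?f = restrict (\<lambda>x. x) (carrier (cA D))"
    using left right by (auto simp: compose_def intro!: restrict_ext simp del: restrict_apply restrict_apply')
  ultimately show ?thesis
    unfolding isomorphism_def Cat1_def using f by (auto intro!: bexI[of _ ?f])
qed

end

section \<open>From crossed modules to cat1-groups\<close>

locale paired_crossed_mod = crossed_mod T X + paired_operations_theory T pair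
  for T :: "('w, 's) gwo_theory" and X :: "('u, 'w, 's) xmod" and pair :: "'u \<times> 'u \<Rightarrow> 'u"
begin

lemma split_extension_actions:
  obtains E i p s where "split_extension_actions T pair A E B i p s dot star"
proof -
  obtain E i p s where "split_extension T A E B i p s"
    "\<forall>b\<in>carrier B. \<forall>a\<in>carrier A. dot b a \<in> carrier A \<and>
      i (dot b a) = s b \<otimes>\<^bsub>E\<^esub> i a \<otimes>\<^bsub>E\<^esub> inv\<^bsub>E\<^esub> (s b)"
    "\<forall>st\<in>binary T. \<forall>b\<in>carrier B. \<forall>a\<in>carrier A. star st b a \<in> carrier A \<and>
      i (star st b a) = bop E st (s b) (i a)"
    using actions unfolding derived_actions_def by blast
  then have "split_extension_actions T pair A E B i p s dot star"
    by unfold_locales auto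
  then show thesis
    by (rule that)
qed

lemma
  shows semidirect_obj: "gwo_obj T (semidirect A B dot star)"
    and dot_one_left: "a \<in> carrier A \<Longrightarrow> dot \<one>\<^bsub>B\<^esub> a = a"
    and dot_one_right: "b \<in> carrier B \<Longrightarrow> dot b \<one>\<^bsub>A\<^esub> = \<one>\<^bsub>A\<^esub>"
    and star_one_left: "st \<in> binary T \<Longrightarrow> a \<in> carrier A \<Longrightarrow> star st \<one>\<^bsub>B\<^esub> a = \<one>\<^bsub>A\<^esub>"
    and star_one_right: "st \<in> binary T \<Longrightarrow> b \<in> carrier B \<Longrightarrow> star st b \<one>\<^bsub>A\<^esub> = \<one>\<^bsub>A\<^esub>"
proof -
  obtain E i p s where "split_extension_actions T pair A E B i p s dot star"
    by (rule split_extension_actions)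
  then interpret S: split_extension_actions T pair A E B i p s dot star .
  show "gwo_obj T (semidirect A B dot star)"
    and "a \<in> carrier A \<Longrightarrow> dot \<one>\<^bsub>B\<^esub> a = a"
    and "b \<in> carrier B \<Longrightarrow> dot b \<one>\<^bsub>A\<^esub> = \<one>\<^bsub>A\<^esub>"
    and "st \<in> binary T \<Longrightarrow> a \<in> carrier A \<Longrightarrow> star st \<one>\<^bsub>B\<^esub> a = \<one>\<^bsub>A\<^esub>"
    and "st \<in> binary T \<Longrightarrow> b \<in> carrier B \<Longrightarrow> star st b \<one>\<^bsub>A\<^esub> = \<one>\<^bsub>A\<^esub>"
    by (rule S.semidirect_obj S.dot_one_left S.dot_one_right S.star_one_left S.star_one_right;
        assumption?)+
qed

lemmas action_simps [simp] = dot_one_left dot_one_right star_one_left star_one_right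
  gwo_hom_mult[OF \<alpha>] gwo_hom_uop[OF \<alpha>] gwo_hom_bop[OF \<alpha>] gwo_hom_one[OF \<alpha> A B]
  gwo_hom_inv[OF \<alpha> A B] \<alpha>_dot dot_\<alpha> star_\<alpha> \<alpha>_star \<alpha>_star_opp closed
  uop_one[OF A] uop_one[OF B] bop_one_left[OF A] bop_one_left[OF B]
  bop_one_right[OF A] bop_one_right[OF B]

end

context paired_operations_theory
begin

definition cat1_of :: "('u, 'w, 's) xmod \<Rightarrow> ('u, 'w, 's) cat1" where
  "cat1_of X = (let S = semidirect (xA X) (xB X) (xdot X) (xstar X) in \<lparr>
     cA = S,
     cs = restrict (\<lambda>z. case unpair z of (a, b) \<Rightarrow> pair (\<one>\<^bsub>xA X\<^esub>, b)) (carrier S),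
     ct = restrict (\<lambda>z. case unpair z of (a, b) \<Rightarrow> pair (\<one>\<^bsub>xA X\<^esub>, xalpha X a \<otimes>\<^bsub>xB X\<^esub> b))
       (carrier S) \<rparr>)"

lemma cat1_of_simps [simp]:
  "cA (cat1_of X) = semidirect (xA X) (xB X) (xdot X) (xstar X)"
  "a \<in> carrier (xA X) \<Longrightarrow> b \<in> carrier (xB X) \<Longrightarrow> cs (cat1_of X) (pair (a, b)) = pair (\<one>\<^bsub>xA X\<^esub>, b)"
  "a \<in> carrier (xA X) \<Longrightarrow> b \<in> carrier (xB X) \<Longrightarrow>
    ct (cat1_of X) (pair (a, b)) = pair (\<one>\<^bsub>xA X\<^esub>, xalpha X a \<otimes>\<^bsub>xB X\<^esub> b)"
  by (simp_all add: cat1_of_def Let_def)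

definition cat1_map ::
  "('u, 'w, 's) xmod \<Rightarrow> ('u, 'w, 's) xmod \<Rightarrow> ('u \<Rightarrow> 'u) \<times> ('u \<Rightarrow> 'u) \<Rightarrow> 'u \<Rightarrow> 'u" where
  "cat1_map X Y \<phi> = restrict (\<lambda>z. pair (map_prod (fst \<phi>) (snd \<phi>) (unpair z)))
     (carrier (cA (cat1_of X)))"

lemma cat1_map_pair [simp]:
  "a \<in> carrier (xA X) \<Longrightarrow> b \<in> carrier (xB X) \<Longrightarrow> cat1_map X Y (f, g) (pair (a, b)) = pair (f a, g b)"
  by (simp add: cat1_map_def)

end

context paired_crossed_mod
begin

lemma cs_hom: "cs (cat1_of X) \<in> gwo_hom T (cA (cat1_of X)) (cA (cat1_of X))"
  by (rule gwo_homI) (auto, simp add: cat1_of_def Let_def)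

text \<open>Compatibility with \<open>+\<close> is the equivariance \<open>\<alpha> (b \<cdot> a) = b + \<alpha> a - b\<close>, and compatibility
  with \<open>\<star>\<close> is the equivariance of \<open>\<alpha>\<close> for \<open>b \<star> a\<close> and \<open>a \<star> b\<close>.\<close>

lemma ct_hom: "ct (cat1_of X) \<in> gwo_hom T (cA (cat1_of X)) (cA (cat1_of X))"
proof -
  have mult: "(\<alpha> a \<otimes>\<^bsub>B\<^esub> (b \<otimes>\<^bsub>B\<^esub> \<alpha> a' \<otimes>\<^bsub>B\<^esub> inv\<^bsub>B\<^esub> b)) \<otimes>\<^bsub>B\<^esub> (b \<otimes>\<^bsub>B\<^esub> b')
      = (\<alpha> a \<otimes>\<^bsub>B\<^esub> b) \<otimes>\<^bsub>B\<^esub> (\<alpha> a' \<otimes>\<^bsub>B\<^esub> b')"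
    if "a \<in> carrier A" "b \<in> carrier B" "a' \<in> carrier A" "b' \<in> carrier B" for a b a' b'
  proof -
    have "inv\<^bsub>B\<^esub> b \<otimes>\<^bsub>B\<^esub> (b \<otimes>\<^bsub>B\<^esub> b') = b'"
      using that by (simp flip: B.m_assoc)
    with that show ?thesis
      by (simp add: B.m_assoc)
  qed
  have bop: "bop B st (\<alpha> a) (\<alpha> a') \<otimes>\<^bsub>B\<^esub> bop B st (\<alpha> a) b' \<otimes>\<^bsub>B\<^esub> bop B st b (\<alpha> a') \<otimes>\<^bsub>B\<^esub> bop B st b b'
      = bop B st (\<alpha> a \<otimes>\<^bsub>B\<^esub> b) (\<alpha> a' \<otimes>\<^bsub>B\<^esub> b')"
    if "st \<in> binary T" "a \<in> carrier A" "b \<in> carrier B" "a' \<in> carrier A" "b' \<in> carrier B"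
    for st a b a' b'
  proof -
    \<comment> \<open>Expanding in the first argument first gives the four terms in the order of the left-hand side.\<close>
    have "bop B st (\<alpha> a \<otimes>\<^bsub>B\<^esub> b) (\<alpha> a' \<otimes>\<^bsub>B\<^esub> b')
        = bop B st (\<alpha> a) (\<alpha> a' \<otimes>\<^bsub>B\<^esub> b') \<otimes>\<^bsub>B\<^esub> bop B st b (\<alpha> a' \<otimes>\<^bsub>B\<^esub> b')"
      using that by (intro bop_distrib_right[OF B]) auto
    with that show ?thesis
      by (simp add: bop_distrib_left[OF B] B.m_assoc)
  qed
  show ?thesis
    by (rule gwo_homI) (auto simp: mult bop uop_distrib[OF B] bop_opp[OF B], simp add: cat1_of_def Let_def)
qed

lemma kernel_cs:
  "kernel (cA (cat1_of X)) (cA (cat1_of X)) (cs (cat1_of X)) = (\<lambda>a. pair (a, \<one>\<^bsub>B\<^esub>)) ` carrier A"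
  by (auto simp: kernel_def)

lemma image_cs:
  "cs (cat1_of X) ` carrier (cA (cat1_of X)) = (\<lambda>b. pair (\<one>\<^bsub>A\<^esub>, b)) ` carrier B"
  by (force simp: image_iff)

lemma kernel_ct:
  "kernel (cA (cat1_of X)) (cA (cat1_of X)) (ct (cat1_of X))
    = (\<lambda>a. pair (a, inv\<^bsub>B\<^esub> (\<alpha> a))) ` carrier A"
proof -
  have "\<alpha> a \<otimes>\<^bsub>B\<^esub> b = \<one>\<^bsub>B\<^esub> \<longleftrightarrow> b = inv\<^bsub>B\<^esub> (\<alpha> a)" if "a \<in> carrier A" "b \<in> carrier B" for a b
    using that B.inv_equality[OF B.inv_comm, of "\<alpha> a" b] by auto
  then show ?thesis
    by (auto simp: kernel_def)
qed

text \<open>The elements of \<open>ker t\<close> have second component \<open>- \<alpha> a' = \<alpha> (- a')\<close>, so the conditions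
  \<open>\<alpha> a \<cdot> a' = a + a' - a\<close> and \<open>\<alpha> a \<star> a' = a \<star> a'\<close> turn every action that occurs in a sum or
  product with \<open>(a, 0)\<close> into an operation of \<open>A\<close>: both sums become \<open>(a + a', - \<alpha> a')\<close>, and the
  product becomes \<open>(a \<star> a' + a \<star> (- a'), 0) = 0\<close>.\<close>

lemma cat1_of_cat1_group: "cat1_group T (cat1_of X)"
proof -
  \<comment> \<open>Rewriting in this direction exposes \<open>\<alpha>\<close> of an element, to which the Peiffer conditions apply.\<close>
  have inv: "inv\<^bsub>B\<^esub> (\<alpha> a) = \<alpha> (inv\<^bsub>A\<^esub> a)" if "a \<in> carrier A" for a
    using that by simp
  have commute: "pair (a, \<one>\<^bsub>B\<^esub>) \<otimes>\<^bsub>cA (cat1_of X)\<^esub> pair (a', inv\<^bsub>B\<^esub> (\<alpha> a'))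
      = pair (a', inv\<^bsub>B\<^esub> (\<alpha> a')) \<otimes>\<^bsub>cA (cat1_of X)\<^esub> pair (a, \<one>\<^bsub>B\<^esub>)"
    if "a \<in> carrier A" "a' \<in> carrier A" for a a'
  proof -
    have "a' \<otimes>\<^bsub>A\<^esub> dot (\<alpha> (inv\<^bsub>A\<^esub> a')) a = a \<otimes>\<^bsub>A\<^esub> a'"
      using that by (simp add: del: gwo_hom_inv[OF \<alpha> A B] flip: A.m_assoc)
    with that show ?thesis
      by (simp add: inv del: gwo_hom_inv[OF \<alpha> A B])
  qed
  have bop: "bop (cA (cat1_of X)) st (pair (a, \<one>\<^bsub>B\<^esub>)) (pair (a', inv\<^bsub>B\<^esub> (\<alpha> a')))
      = \<one>\<^bsub>cA (cat1_of X)\<^esub>"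
    if "st \<in> binary T" "a \<in> carrier A" "a' \<in> carrier A" for st a a'
    using that bop_inv_right[OF A, of st a a']
    by (simp add: inv bop_opp[OF A] del: gwo_hom_inv[OF \<alpha> A B])
  show ?thesis
    unfolding cat1_group_def Let_def kernel_cs kernel_ct
    using semidirect_obj cs_hom ct_hom commute bop by (auto simp del: semidirect_simps(2-))
qed

end

lemma (in paired_operations_theory) cat1_map_hom:
  assumes X: "crossed_module T X" and Y: "crossed_module T Y" and \<phi>: "\<phi> \<in> xmod_hom T X Y"
  shows "cat1_map X Y \<phi> \<in> cat1_hom T (cat1_of X) (cat1_of Y)"
proof -
  interpret X: paired_crossed_mod T X pair by unfold_locales (rule X)
  interpret Y: paired_crossed_mod T Y pair by unfold_locales (rule Y)
  obtain f g where \<phi>_def: "\<phi> = (f, g)" by (cases \<phi>)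
  note fg = \<phi>[unfolded \<phi>_def]
  note f = xmod_hom_fst[OF fg] and g = xmod_hom_snd[OF fg]
  note [simp] = gwo_hom_closed[OF f] gwo_hom_mult[OF f] gwo_hom_uop[OF f] gwo_hom_bop[OF f]
    gwo_hom_closed[OF g] gwo_hom_mult[OF g] gwo_hom_uop[OF g] gwo_hom_bop[OF g]
    gwo_hom_one[OF f X.A Y.A] gwo_hom_one[OF g X.B Y.B]
    xmod_hom_alpha[OF fg] xmod_hom_dot[OF fg] xmod_hom_star[OF fg]
  have "cat1_map X Y (f, g) \<in> gwo_hom T (cA (cat1_of X)) (cA (cat1_of Y))"
    by (rule gwo_homI) (auto, simp add: cat1_map_def)
  then show ?thesis
    unfolding \<phi>_def cat1_hom_def by auto
qed

lemma (in paired_operations_theory) functor_cat1_of: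
  "is_functor (XMod T) (Cat1 T) cat1_of cat1_map"
  unfolding is_functor_def
proof (intro conjI ballI)
  fix X :: "('u, 'w, 's) xmod" assume "X \<in> Obj (XMod T)"
  then interpret paired_crossed_mod T X pair by unfold_locales (simp add: XMod_def)
  show "cat1_of X \<in> Obj (Cat1 T)"
    using cat1_of_cat1_group by (simp add: Cat1_def)
  show "cat1_map X X (Ident (XMod T) X) = Ident (Cat1 T) (cat1_of X)"
    by (auto simp: cat1_map_def XMod_def Cat1_def intro!: restrict_ext)
next
  fix X Y :: "('u, 'w, 's) xmod" and \<phi>
  assume "X \<in> Obj (XMod T)" "Y \<in> Obj (XMod T)" "\<phi> \<in> Hom (XMod T) X Y"
  then show "cat1_map X Y \<phi> \<in> Hom (Cat1 T) (cat1_of X) (cat1_of Y)"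
    by (simp add: XMod_def Cat1_def cat1_map_hom)
next
  fix X Y Z :: "('u, 'w, 's) xmod" and \<phi> \<psi>
  assume "\<phi> \<in> Hom (XMod T) X Y"
  then show "cat1_map X Z (Comp (XMod T) X Y Z \<psi> \<phi>)
      = Comp (Cat1 T) (cat1_of X) (cat1_of Y) (cat1_of Z) (cat1_map Y Z \<psi>) (cat1_map X Y \<phi>)"
    by (cases \<phi>; cases \<psi>)
      (auto simp: cat1_map_def XMod_def Cat1_def compose_def gwo_hom_closed[OF xmod_hom_fst]
        gwo_hom_closed[OF xmod_hom_snd] intro!: restrict_ext)
qed

section \<open>From cat1-groups to crossed modules\<close>

definition xmod_of :: "('u, 'w, 's) cat1 \<Rightarrow> ('u, 'w, 's) xmod" where
  "xmod_of C = (let G = cA C; K = kernel G G (cs C) in \<lparr>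
     xA = subobject G K,
     xB = subobject G (cs C ` carrier G),
     xdot = (\<lambda>b a. b \<otimes>\<^bsub>G\<^esub> a \<otimes>\<^bsub>G\<^esub> inv\<^bsub>G\<^esub> b),
     xstar = bop G,
     xalpha = restrict (ct C) K \<rparr>)"

lemma xmod_of_simps [simp]:
  "xA (xmod_of C) = subobject (cA C) (kernel (cA C) (cA C) (cs C))"
  "xB (xmod_of C) = subobject (cA C) (cs C ` carrier (cA C))"
  "xdot (xmod_of C) b a = b \<otimes>\<^bsub>cA C\<^esub> a \<otimes>\<^bsub>cA C\<^esub> inv\<^bsub>cA C\<^esub> b"
  "xstar (xmod_of C) = bop (cA C)"
  "xalpha (xmod_of C) = restrict (ct C) (kernel (cA C) (cA C) (cs C))"
  by (simp_all add: xmod_of_def Let_def)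

definition xmod_map :: "('u, 'w, 's) cat1 \<Rightarrow> ('u \<Rightarrow> 'u) \<Rightarrow> ('u \<Rightarrow> 'u) \<times> ('u \<Rightarrow> 'u)" where
  "xmod_map C f = (restrict f (carrier (xA (xmod_of C))), restrict f (carrier (xB (xmod_of C))))"

context cat1_gwo
begin

abbreviation "K \<equiv> kernel G G s"
abbreviation "I \<equiv> s ` carrier G"

lemmas st_simps [simp] =
  gwo_hom_closed[OF s] gwo_hom_mult[OF s] gwo_hom_uop[OF s] gwo_hom_bop[OF s]
  gwo_hom_one[OF s G G] gwo_hom_inv[OF s G G]
  gwo_hom_closed[OF t] gwo_hom_mult[OF t] gwo_hom_uop[OF t] gwo_hom_bop[OF t]
  gwo_hom_one[OF t G G] gwo_hom_inv[OF t G G]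
  s_t t_s gwo_obj_uop_closed[OF G] gwo_obj_bop_closed[OF G]
  uop_one[OF G] bop_one_left[OF G] bop_one_right[OF G]

lemma s_s [simp]: "x \<in> carrier G \<Longrightarrow> s (s x) = s x"
  using s_t[of "s x"] by (simp del: s_t)

lemma t_t [simp]: "x \<in> carrier G \<Longrightarrow> t (t x) = t x"
  using t_s[of "t x"] by (simp del: t_s)

lemma K_iff: "x \<in> K \<longleftrightarrow> x \<in> carrier G \<and> s x = \<one>\<^bsub>G\<^esub>"
  by (simp add: kernel_def)

text \<open>From \<open>s t = t\<close> and \<open>t s = s\<close> follows \<open>s s = s\<close>, so the image of \<open>s\<close> is its set of fixed
  points; \<open>t\<close> fixes the same points.\<close>

lemma I_iff: "x \<in> I \<longleftrightarrow> x \<in> carrier G \<and> s x = x"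
  by (auto simp: image_iff) (metis)

lemma I_t: "x \<in> I \<Longrightarrow> t x = x"
  by auto

lemma K_obj: "gwo_obj T (subobject G K)"
  by (rule kernel_subobject_obj[OF G G s])

lemma I_obj: "gwo_obj T (subobject G I)"
  by (rule image_subobject_obj[OF G G s])

lemma K_subgroup: "subgroup K G"
  by (rule group_hom.subgroup_kernel[OF gwo_hom_group_hom[OF s G G]])

lemma I_subgroup: "subgroup I G"
  by (rule group_hom.img_is_subgroup[OF gwo_hom_group_hom[OF s G G]])

lemma conjugate_K: "b \<in> I \<Longrightarrow> a \<in> K \<Longrightarrow> b \<otimes>\<^bsub>G\<^esub> a \<otimes>\<^bsub>G\<^esub> inv\<^bsub>G\<^esub> b \<in> K"
  by (auto simp: K_iff)

lemma bop_K: "st \<in> binary T \<Longrightarrow> b \<in> I \<Longrightarrow> a \<in> K \<Longrightarrow> bop G st b a \<in> K"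
  by (auto simp: K_iff)

text \<open>The idempotent \<open>s\<close> splits \<open>G\<close> over its image, with the inclusion as section. The induced
  actions of \<open>im s\<close> on \<open>ker s\<close> are conjugation and multiplication inside \<open>G\<close>.\<close>

lemma split_extension_K_I:
  "split_extension T (subobject G K) G (subobject G I) (restrict (\<lambda>x. x) K) s (restrict (\<lambda>x. x) I)"
proof -
  have "restrict (\<lambda>x. x) K \<in> gwo_hom T (subobject G K) G"
    by (rule gwo_homI) (auto simp: K_iff)
  moreover have "restrict (\<lambda>x. x) I \<in> gwo_hom T (subobject G I) G"
    by (rule gwo_homI) (auto simp: I_iff)
  moreover have "s \<in> gwo_hom T G (subobject G I)"
    by (rule gwo_homI) (auto simp: gwo_hom_extensional[OF s])
  moreover have "kernel G (subobject G I) s = K"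
    by (simp add: kernel_def)
  ultimately show ?thesis
    by (auto simp: split_extension_def G K_obj I_obj inj_on_def)
qed

lemma derived_actions_K_I:
  "derived_actions T (subobject G I) (subobject G K) (\<lambda>b a. b \<otimes>\<^bsub>G\<^esub> a \<otimes>\<^bsub>G\<^esub> inv\<^bsub>G\<^esub> b) (bop G)"
  unfolding derived_actions_def
  using split_extension_K_I conjugate_K bop_K
  by (intro exI[of _ G] exI[of _ "restrict (\<lambda>x. x) K"] exI[of _ s] exI[of _ "restrict (\<lambda>x. x) I"])
    auto

lemma t_quotient_kernel:
  assumes "a \<in> carrier G"
  shows "inv\<^bsub>G\<^esub> a \<otimes>\<^bsub>G\<^esub> t a \<in> kernel G G t" and "a \<otimes>\<^bsub>G\<^esub> (inv\<^bsub>G\<^esub> a \<otimes>\<^bsub>G\<^esub> t a) = t a"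
  using assms by (simp_all add: kernel_def flip: G.m_assoc)

text \<open>With \<open>k = - a + t a \<in> ker t\<close>, which commutes with \<open>a' \<in> ker s\<close>, conjugation by
  \<open>t a = a + k\<close> agrees on \<open>a'\<close> with conjugation by \<open>a\<close>.\<close>

lemma peiffer:
  assumes a: "a \<in> K" and a': "a' \<in> K"
  shows "t a \<otimes>\<^bsub>G\<^esub> a' \<otimes>\<^bsub>G\<^esub> inv\<^bsub>G\<^esub> (t a) = a \<otimes>\<^bsub>G\<^esub> a' \<otimes>\<^bsub>G\<^esub> inv\<^bsub>G\<^esub> a"
proof -
  have carr [simp]: "a \<in> carrier G" "a' \<in> carrier G"
    using assms by (auto simp: K_iff)
  let ?k = "inv\<^bsub>G\<^esub> a \<otimes>\<^bsub>G\<^esub> t a"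
  have "a' \<otimes>\<^bsub>G\<^esub> ?k = ?k \<otimes>\<^bsub>G\<^esub> a'"
    by (rule kernels_commute[OF a' t_quotient_kernel(1)]) simp
  then have "t a \<otimes>\<^bsub>G\<^esub> a' = a \<otimes>\<^bsub>G\<^esub> (a' \<otimes>\<^bsub>G\<^esub> ?k)"
    using t_quotient_kernel(2)[of a] by (simp add: G.m_assoc[symmetric] del: G.inv_mult_group)
  also have "\<dots> = a \<otimes>\<^bsub>G\<^esub> a' \<otimes>\<^bsub>G\<^esub> inv\<^bsub>G\<^esub> a \<otimes>\<^bsub>G\<^esub> t a"
    by (simp add: G.m_assoc)
  finally show ?thesis
    by (simp add: G.m_assoc)
qed

text \<open>Likewise \<open>t a \<star> a' = a \<star> a' + k \<star> a'\<close>. The axiom is about products \<open>ker s \<star> ker t\<close>; applied to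
  the opposite operation, it gives \<open>k \<star> a' = a' \<star>\<^sup>\<circ> k = 0\<close>.\<close>

lemma peiffer_bop:
  assumes st: "st \<in> binary T" and a: "a \<in> K" and a': "a' \<in> K"
  shows "bop G st (t a) a' = bop G st a a'"
proof -
  have carr [simp]: "a \<in> carrier G" "a' \<in> carrier G"
    using assms by (auto simp: K_iff)
  let ?k = "inv\<^bsub>G\<^esub> a \<otimes>\<^bsub>G\<^esub> t a"
  have "bop G st (t a) a' = bop G st (a \<otimes>\<^bsub>G\<^esub> ?k) a'"
    by (simp add: t_quotient_kernel(2))
  also have "\<dots> = bop G st a a' \<otimes>\<^bsub>G\<^esub> bop G st ?k a'"
    using st by (intro bop_distrib_right[OF G]) auto
  also have "bop G st ?k a' = bop G (opp T st) a' ?k"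
    using st by (simp add: bop_opp[OF G])
  also have "\<dots> = \<one>\<^bsub>G\<^esub>"
    by (rule kernels_bop[OF opp_closed[OF st] a' t_quotient_kernel(1)]) simp
  finally show ?thesis
    using st by simp
qed

lemma xmod_of_crossed_module: "crossed_module T (xmod_of C)"
proof -
  have t_I: "t x \<in> I" if "x \<in> carrier G" for x
    using that by (simp add: I_iff)
  have "restrict t K \<in> gwo_hom T (subobject G K) (subobject G I)"
    by (rule gwo_homI) (auto simp: K_iff I_iff)
  moreover have "t (b \<otimes>\<^bsub>G\<^esub> a \<otimes>\<^bsub>G\<^esub> inv\<^bsub>G\<^esub> b) = b \<otimes>\<^bsub>G\<^esub> t a \<otimes>\<^bsub>G\<^esub> inv\<^bsub>subobject G I\<^esub> b"
    if "b \<in> I" "a \<in> K" for b a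
    using that subobject_inv[OF G I_subgroup, of b] I_t[of b] by (simp add: K_iff I_iff)
  moreover have "t a \<otimes>\<^bsub>G\<^esub> a' \<otimes>\<^bsub>G\<^esub> inv\<^bsub>G\<^esub> (t a) = a \<otimes>\<^bsub>G\<^esub> a' \<otimes>\<^bsub>G\<^esub> inv\<^bsub>subobject G K\<^esub> a"
    if "a \<in> K" "a' \<in> K" for a a'
    using that peiffer subobject_inv[OF G K_subgroup, of a] by simp
  moreover have "t (bop G st b a) = bop G st b (t a)" "t (bop G (opp T st) b a) = bop G st (t a) b"
    if "st \<in> binary T" "b \<in> I" "a \<in> K" for st b a
    using that I_t[of b] by (simp_all add: K_iff I_iff bop_opp[OF G])
  ultimately show ?thesis
    unfolding crossed_module_def Let_def
    using K_obj I_obj derived_actions_K_I conjugate_K bop_K peiffer_bop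
    by (auto simp: xmod_of_def Let_def opp_closed simp del: st_simps)
qed

end

context operations_theory
begin

lemma xmod_map_hom:
  fixes C D :: "('u, 'w, 's) cat1"
  assumes C: "cat1_group T C" and D: "cat1_group T D" and f: "f \<in> cat1_hom T C D"
  shows "xmod_map C f \<in> xmod_hom T (xmod_of C) (xmod_of D)"
proof -
  interpret C: cat1_gwo T C by unfold_locales (rule C)
  interpret D: cat1_gwo T D by unfold_locales (rule D)
  note f' = cat1_hom_gwo[OF f]
  note [simp] = gwo_hom_closed[OF f'] gwo_hom_mult[OF f'] gwo_hom_uop[OF f'] gwo_hom_bop[OF f']
    gwo_hom_inv[OF f' C.G D.G] gwo_hom_one[OF f' C.G D.G]
  have f_s: "D.s (f x) = f (C.s x)" and f_t: "D.t (f x) = f (C.t x)" if "x \<in> carrier C.G" for x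
    using that cat1_hom_s[OF f] cat1_hom_t[OF f] by simp_all
  have "restrict f C.K \<in> gwo_hom T (subobject C.G C.K) (subobject D.G D.K)"
    by (rule gwo_homI) (auto simp: C.K_iff D.K_iff f_s)
  moreover have "restrict f C.I \<in> gwo_hom T (subobject C.G C.I) (subobject D.G D.I)"
    by (rule gwo_homI) (auto simp: C.I_iff D.I_iff f_s)
  ultimately show ?thesis
    by (auto simp: xmod_map_def xmod_hom_def C.K_iff D.K_iff C.I_iff f_s f_t)
qed

lemma functor_xmod_of:
  "is_functor (Cat1 T :: (('u, 'w, 's) cat1, _) cat) (XMod T) xmod_of (\<lambda>C D. xmod_map C)"
  unfolding is_functor_def
proof (intro conjI ballI)
  fix C :: "('u, 'w, 's) cat1" assume "C \<in> Obj (Cat1 T)"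
  then interpret cat1_gwo T C by unfold_locales (simp add: Cat1_def)
  show "xmod_of C \<in> Obj (XMod T)"
    using xmod_of_crossed_module by (simp add: XMod_def)
  show "xmod_map C (Ident (Cat1 T) C) = Ident (XMod T) (xmod_of C)"
    by (auto simp: xmod_map_def XMod_def Cat1_def K_iff I_iff intro!: restrict_ext)
next
  fix C D :: "('u, 'w, 's) cat1" and f
  assume "C \<in> Obj (Cat1 T)" "D \<in> Obj (Cat1 T)" "f \<in> Hom (Cat1 T) C D"
  then show "xmod_map C f \<in> Hom (XMod T) (xmod_of C) (xmod_of D)"
    by (simp add: XMod_def Cat1_def xmod_map_hom)
next
  fix C D E :: "('u, 'w, 's) cat1" and f g
  assume C: "C \<in> Obj (Cat1 T)" and D: "D \<in> Obj (Cat1 T)" and "f \<in> Hom (Cat1 T) C D"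
  then have f: "f \<in> cat1_hom T C D"
    by (simp add: Cat1_def)
  interpret C: cat1_gwo T C using C by unfold_locales (simp add: Cat1_def)
  interpret D: cat1_gwo T D using D by unfold_locales (simp add: Cat1_def)
  note f' = cat1_hom_gwo[OF f]
  show "xmod_map C (Comp (Cat1 T) C D E g f)
      = Comp (XMod T) (xmod_of C) (xmod_of D) (xmod_of E) (xmod_map D g) (xmod_map C f)"
    by (auto simp: xmod_map_def XMod_def Cat1_def compose_def C.K_iff D.K_iff C.I_iff D.I_iff
        gwo_hom_closed[OF f'] gwo_hom_one[OF f' C.G D.G] simp flip: cat1_hom_s[OF f]
        intro!: restrict_ext)
qed

end

section \<open>The equivalence\<close>

context paired_operations_theory
begin

definition unit :: "('u, 'w, 's) xmod \<Rightarrow> ('u \<Rightarrow> 'u) \<times> ('u \<Rightarrow> 'u)" where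
  "unit X = (restrict (\<lambda>a. pair (a, \<one>\<^bsub>xB X\<^esub>)) (carrier (xA X)),
     restrict (\<lambda>b. pair (\<one>\<^bsub>xA X\<^esub>, b)) (carrier (xB X)))"

text \<open>In \<open>A \<rtimes> B\<close> the kernel of \<open>s\<close> is \<open>{(a, 0)}\<close> and the image of \<open>s\<close> is \<open>{(0, b)}\<close>. The crossed
  module recovered from them has the original actions, as \<open>(b \<cdot> a, 0) + (0, b) = (0, b) + (a, 0)\<close>
  and \<open>(0, b) \<star> (a, 0) = (b \<star> a, 0)\<close>.\<close>

lemma unit_isomorphism:
  assumes "crossed_module T X"
  shows "isomorphism (XMod T) X (xmod_of (cat1_of X)) (unit X)"
proof -
  interpret X: paired_crossed_mod T X pair by unfold_locales (rule assms)
  interpret C: cat1_gwo T "cat1_of X" by unfold_locales (rule X.cat1_of_cat1_group)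
  let ?f = "restrict (\<lambda>a. pair (a, \<one>\<^bsub>X.B\<^esub>)) (carrier X.A)"
  let ?g = "restrict (\<lambda>b. pair (\<one>\<^bsub>X.A\<^esub>, b)) (carrier X.B)"
  have f: "?f \<in> gwo_hom T X.A (xA (xmod_of (cat1_of X)))"
    by (rule gwo_homI) (auto simp: kernel_def simp del: C.st_simps)
  have g: "?g \<in> gwo_hom T X.B (xB (xmod_of (cat1_of X)))"
    by (rule gwo_homI) (auto simp: X.image_cs simp del: C.st_simps cat1_of_simps(1),
      auto simp del: C.st_simps)
  have dot: "pair (X.dot b a, \<one>\<^bsub>X.B\<^esub>) = pair (\<one>\<^bsub>X.A\<^esub>, b) \<otimes>\<^bsub>C.G\<^esub> pair (a, \<one>\<^bsub>X.B\<^esub>) \<otimes>\<^bsub>C.G\<^esub>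
      inv\<^bsub>C.G\<^esub> (pair (\<one>\<^bsub>X.A\<^esub>, b))"
    if "a \<in> carrier X.A" "b \<in> carrier X.B" for a b
  proof (rule C.G.inv_solve_right[THEN iffD2])
    show "pair (\<one>\<^bsub>X.A\<^esub>, b) \<otimes>\<^bsub>C.G\<^esub> pair (a, \<one>\<^bsub>X.B\<^esub>) = pair (X.dot b a, \<one>\<^bsub>X.B\<^esub>) \<otimes>\<^bsub>C.G\<^esub> pair (\<one>\<^bsub>X.A\<^esub>, b)"
      using that by simp
  qed (use that in auto)
  have "(?f, ?g) \<in> xmod_hom T X (xmod_of (cat1_of X))"
    using f g dot by (auto simp: xmod_hom_def kernel_def simp del: C.st_simps)
  moreover have "bij_betw ?f (carrier X.A) (carrier (xA (xmod_of (cat1_of X))))"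
    and "bij_betw ?g (carrier X.B) (carrier (xB (xmod_of (cat1_of X))))"
    unfolding xmod_of_simps subobject_simps X.kernel_cs X.image_cs
    by (auto simp: bij_betw_def inj_on_def)
  ultimately show ?thesis
    unfolding unit_def
    by (intro isomorphism_XModI assms C.xmod_of_crossed_module)
qed

lemma unit_natural:
  "natural_isomorphism (XMod T) (XMod T) (\<lambda>X. X) (\<lambda>X Y f. f) (\<lambda>X. xmod_of (cat1_of X))
     (\<lambda>X Y f. xmod_map (cat1_of X) (cat1_map X Y f)) unit"
  unfolding natural_isomorphism_def
proof (intro conjI ballI)
  fix X :: "('u, 'w, 's) xmod" assume "X \<in> Obj (XMod T)"
  then show "isomorphism (XMod T) X (xmod_of (cat1_of X)) (unit X)"
    by (intro unit_isomorphism) (simp add: XMod_def)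
next
  fix X Y :: "('u, 'w, 's) xmod" and \<phi>
  assume X: "X \<in> Obj (XMod T)" and Y: "Y \<in> Obj (XMod T)" and "\<phi> \<in> Hom (XMod T) X Y"
  then obtain f g where \<phi>: "\<phi> = (f, g)" and fg: "(f, g) \<in> xmod_hom T X Y"
    by (cases \<phi>) (simp add: XMod_def)
  interpret X: paired_crossed_mod T X pair using X by unfold_locales (simp add: XMod_def)
  interpret Y: paired_crossed_mod T Y pair using Y by unfold_locales (simp add: XMod_def)
  note f = xmod_hom_fst[OF fg] and g = xmod_hom_snd[OF fg]
  show "Comp (XMod T) X (xmod_of (cat1_of X)) (xmod_of (cat1_of Y))
      (xmod_map (cat1_of X) (cat1_map X Y \<phi>)) (unit X) =
    Comp (XMod T) X Y (xmod_of (cat1_of Y)) (unit Y) \<phi>"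
    using X.kernel_cs X.image_cs
    by (auto simp: \<phi> XMod_def unit_def xmod_map_def compose_def gwo_hom_closed[OF f]
        gwo_hom_closed[OF g] gwo_hom_one[OF f X.A Y.A] gwo_hom_one[OF g X.B Y.B]
        intro!: restrict_ext)
qed

definition counit :: "('u, 'w, 's) cat1 \<Rightarrow> 'u \<Rightarrow> 'u" where
  "counit C = restrict (\<lambda>z. case unpair z of (a, b) \<Rightarrow> a \<otimes>\<^bsub>cA C\<^esub> b)
     (carrier (cA (cat1_of (xmod_of C))))"

text \<open>The counit is the bijection from the semidirect product to the middle term of the split
  extension \<open>ker s \<rightarrow> G \<rightarrow> im s\<close>. It respects \<open>s\<close> and \<open>t\<close>, since \<open>s (a + b) = b\<close> and
  \<open>t (a + b) = t a + b\<close> for \<open>a \<in> ker s\<close> and \<open>b \<in> im s\<close>.\<close>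

lemma counit_isomorphism:
  assumes "cat1_group T C"
  shows "isomorphism (Cat1 T) (cat1_of (xmod_of C)) C (counit C)"
proof -
  interpret C: cat1_gwo T C by unfold_locales (rule assms)
  let ?X = "xmod_of C"
  interpret X: paired_crossed_mod T ?X pair by unfold_locales (rule C.xmod_of_crossed_module)
  interpret S: split_extension_actions T pair "xA ?X" C.G "xB ?X" "restrict (\<lambda>x. x) C.K" C.s
    "restrict (\<lambda>x. x) C.I" "xdot ?X" "xstar ?X"
    by unfold_locales (use C.split_extension_K_I C.conjugate_K C.bop_K in auto)
  have eq: "counit C = S.to_extension"
    unfolding counit_def S.to_extension_def by (auto intro!: restrict_ext)
  have "counit C \<in> gwo_hom T (cA (cat1_of ?X)) C.G"
    using S.to_extension_hom by (simp add: eq)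
  then have "counit C \<in> cat1_hom T (cat1_of ?X) C"
    by (auto simp: cat1_hom_def counit_def C.K_iff C.I_iff C.I_t)
  moreover have "bij_betw (counit C) (carrier (cA (cat1_of ?X))) (carrier C.G)"
    using S.to_extension_bij by (simp add: eq)
  ultimately show ?thesis
    by (intro isomorphism_Cat1I X.cat1_of_cat1_group)
qed

lemma counit_natural:
  "natural_isomorphism (Cat1 T) (Cat1 T) (\<lambda>C. cat1_of (xmod_of C))
     (\<lambda>C D f. cat1_map (xmod_of C) (xmod_of D) (xmod_map C f)) (\<lambda>C. C) (\<lambda>C D f. f) counit"
  unfolding natural_isomorphism_def
proof (intro conjI ballI)
  fix C :: "('u, 'w, 's) cat1" assume "C \<in> Obj (Cat1 T)"
  then show "isomorphism (Cat1 T) (cat1_of (xmod_of C)) C (counit C)"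
    by (intro counit_isomorphism) (simp add: Cat1_def)
next
  fix C D :: "('u, 'w, 's) cat1" and f
  assume C: "C \<in> Obj (Cat1 T)" and D: "D \<in> Obj (Cat1 T)" and "f \<in> Hom (Cat1 T) C D"
  then have f: "f \<in> cat1_hom T C D"
    by (simp add: Cat1_def)
  interpret C: cat1_gwo T C using C by unfold_locales (simp add: Cat1_def)
  interpret D: cat1_gwo T D using D by unfold_locales (simp add: Cat1_def)
  note f' = cat1_hom_gwo[OF f]
  show "Comp (Cat1 T) (cat1_of (xmod_of C)) C D f (counit C) =
    Comp (Cat1 T) (cat1_of (xmod_of C)) (cat1_of (xmod_of D)) D (counit D)
      (cat1_map (xmod_of C) (xmod_of D) (xmod_map C f))"
    by (auto simp: Cat1_def counit_def xmod_map_def cat1_map_def compose_def gwo_hom_mult[OF f']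
        gwo_hom_closed[OF f'] gwo_hom_one[OF f' C.G D.G] C.K_iff D.K_iff C.I_iff D.I_iff
        simp flip: cat1_hom_s[OF f] intro!: restrict_ext)
qed

lemma equivalent_XMod_Cat1:
  "equivalent_categories (XMod T :: (('u, 'w, 's) xmod, _) cat) (Cat1 T :: (('u, 'w, 's) cat1, _) cat)"
  unfolding equivalent_categories_def
  by (intro conjI exI)
    (rule category_XMod category_Cat1 functor_cat1_of functor_xmod_of unit_natural counit_natural)+

end

theorem theorem6p3:
  fixes T :: "('w, 's) gwo_theory"
  assumes "groups_with_operations T"
    and "infinite (UNIV :: 'u set)"
  shows "equivalent_categories
    (XMod T :: (('u, 'w, 's) xmod, ('u \<Rightarrow> 'u) \<times> ('u \<Rightarrow> 'u)) cat)
    (Cat1 T :: (('u, 'w, 's) cat1, 'u \<Rightarrow> 'u) cat)"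
proof -
  \<comment> \<open>An infinite set is equinumerous with its square.\<close>
  obtain pair :: "'u \<times> 'u \<Rightarrow> 'u" where "bij_betw pair (UNIV \<times> UNIV) UNIV"
    using card_of_Times_same_infinite[OF assms(2)] by (auto simp flip: card_of_ordIso)
  then have "inj pair"
    by (simp add: bij_betw_def)
  then interpret paired_operations_theory T pair
    using assms(1) by unfold_locales
  show ?thesis
    by (rule equivalent_XMod_Cat1)
qed

end
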